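(* Let $\Omega\subset\mathbb{R}^n$ be a bounded domain, $(d_1,d_2,f,\kappa)\in(0,\infty)^4$, and for $\ell\in\{1,2\}$ let $\gamma_\ell:\Omega\times\Omega\to[0,\infty)$ be measurable with $\int_\Omega\gamma_\ell(y,x)\,\mathrm{d}y=\int_\Omega\gamma_\ell(x,y)\,\mathrm{d}y\le\gamma_\infty<\infty$ for $x\in\Omega$ and some $\gamma_\infty\ge1$. Consider the system $$\partial_t u=d_1\Gamma_{\gamma_1}u-uv^2+f(1-u),\qquad \partial_t v=d_2\Gamma_{\gamma_2}v+uv^2-(f+\kappa)v\quad\text{in }(0,\infty)\times\Omega,\qquad (u,v)(0)=(u^0,v^0).$$ Then the semi-trivial steady state $(1,0)$ is locally asymptotically stable in $X^2$. Moreover, if $(u^0,v^0)\in X^+\times X^+$ satisfies $$\|u^0\|_\infty\le1+\delta\quad\text{and}\quad\|v^0\|_\infty<\frac{f+\kappa}{1+\delta}$$ for some $\delta\ge0$, then the corresponding solution $(u,v)$ satisfies $\lim_{t\to\infty}\{\|u(t)-1\|_\infty+\|v(t)\|_\infty\}=0$, together with $\|u(t)\|_\infty\le1+\delta$ and $\|v(t)\|_\infty\le\|v^0\|_\infty$ for all $t\ge0$.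
   Context: $X:=L_\infty(\Omega)$ with norm $\|\cdot\|_\infty$, $X^+:=\{z\in X: z\ge0\text{ a.e.}\}$. For measurable $\gamma\ge0$, $\Gamma_\gamma z(x):=\int_\Omega\gamma(x,y)(z(y)-z(x))\,\mathrm{d}y$. For $(u^0,v^0)\in X^+\times X^+$, the system has a unique global solution $(u,v)\in C^1([0,\infty),X^+\times X^+)$. *)

theory Defs
  imports "HOL-Analysis.Analysis"
begin

type_synonym 'n field = "real ^ 'n \<Rightarrow> real"

text \<open>The space X = L_infinity(Omega): measurable, essentially bounded functions
  (elements are identified up to a.e. equality through the seminorm below).\<close>
definition Xsp :: "(real ^ 'n) set \<Rightarrow> 'n field set" where
  "Xsp \<Omega> = {z. z \<in> borel_measurable (lebesgue_on \<Omega>) \<and>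
                  (\<exists>C. AE x in lebesgue_on \<Omega>. \<bar>z x\<bar> \<le> C)}"

definition Xplus :: "(real ^ 'n) set \<Rightarrow> 'n field set" where
  "Xplus \<Omega> = {z \<in> Xsp \<Omega>. AE x in lebesgue_on \<Omega>. 0 \<le> z x}"

definition Linf :: "(real ^ 'n) set \<Rightarrow> 'n field \<Rightarrow> real" where
  "Linf \<Omega> z = Inf {C. 0 \<le> C \<and> (AE x in lebesgue_on \<Omega>. \<bar>z x\<bar> \<le> C)}"

definition Gam :: "(real ^ 'n) set \<Rightarrow> (real ^ 'n \<Rightarrow> real ^ 'n \<Rightarrow> real) \<Rightarrow> 'n field \<Rightarrow> 'n field" where
  "Gam \<Omega> \<gamma> z x = integral\<^sup>L (lebesgue_on \<Omega>) (\<lambda>y. \<gamma> x y * (z y - z x))"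

definition Fu :: "(real ^ 'n) set \<Rightarrow> real \<Rightarrow> real \<Rightarrow> (real ^ 'n \<Rightarrow> real ^ 'n \<Rightarrow> real)
                   \<Rightarrow> 'n field \<Rightarrow> 'n field \<Rightarrow> 'n field" where
  "Fu \<Omega> d1 f \<gamma>1 u v x = d1 * Gam \<Omega> \<gamma>1 u x - u x * (v x)\<^sup>2 + f * (1 - u x)"

definition Fv :: "(real ^ 'n) set \<Rightarrow> real \<Rightarrow> real \<Rightarrow> real \<Rightarrow> (real ^ 'n \<Rightarrow> real ^ 'n \<Rightarrow> real)
                   \<Rightarrow> 'n field \<Rightarrow> 'n field \<Rightarrow> 'n field" where
  "Fv \<Omega> d2 f \<kappa> \<gamma>2 u v x = d2 * Gam \<Omega> \<gamma>2 v x + u x * (v x)\<^sup>2 - (f + \<kappa>) * v x"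

definition C1_X :: "(real ^ 'n) set \<Rightarrow> (real \<Rightarrow> 'n field) \<Rightarrow> (real \<Rightarrow> 'n field) \<Rightarrow> bool" where
  "C1_X \<Omega> w W \<longleftrightarrow>
     (\<forall>t\<ge>0. w t \<in> Xsp \<Omega> \<and> W t \<in> Xsp \<Omega>) \<and>
     (\<forall>t\<ge>0. ((\<lambda>h. Linf \<Omega> (\<lambda>x. (w (t + h) x - w t x) / h - W t x)) \<longlongrightarrow> 0)
               (at 0 within {-t..})) \<and>
     (\<forall>t\<ge>0. ((\<lambda>s. Linf \<Omega> (\<lambda>x. W s x - W t x)) \<longlongrightarrow> 0) (at t within {0..}))"

definition is_solution ::
  "(real ^ 'n) set \<Rightarrow> real \<Rightarrow> real \<Rightarrow> real \<Rightarrow> real \<Rightarrow>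
   (real ^ 'n \<Rightarrow> real ^ 'n \<Rightarrow> real) \<Rightarrow> (real ^ 'n \<Rightarrow> real ^ 'n \<Rightarrow> real) \<Rightarrow>
   'n field \<Rightarrow> 'n field \<Rightarrow> (real \<Rightarrow> 'n field) \<Rightarrow> (real \<Rightarrow> 'n field) \<Rightarrow> bool" where
  "is_solution \<Omega> d1 d2 f \<kappa> \<gamma>1 \<gamma>2 u0 v0 u v \<longleftrightarrow>
     C1_X \<Omega> u (\<lambda>t. Fu \<Omega> d1 f \<gamma>1 (u t) (v t)) \<and>
     C1_X \<Omega> v (\<lambda>t. Fv \<Omega> d2 f \<kappa> \<gamma>2 (u t) (v t)) \<and>
     (AE x in lebesgue_on \<Omega>. u 0 x = u0 x) \<and>
     (AE x in lebesgue_on \<Omega>. v 0 x = v0 x)"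

definition loc_asympt_stable_10 ::
  "(real ^ 'n) set \<Rightarrow> real \<Rightarrow> real \<Rightarrow> real \<Rightarrow> real \<Rightarrow>
   (real ^ 'n \<Rightarrow> real ^ 'n \<Rightarrow> real) \<Rightarrow> (real ^ 'n \<Rightarrow> real ^ 'n \<Rightarrow> real) \<Rightarrow> bool" where
  "loc_asympt_stable_10 \<Omega> d1 d2 f \<kappa> \<gamma>1 \<gamma>2 \<longleftrightarrow>
     (\<forall>\<epsilon>>0. \<exists>\<eta>>0. \<forall>u0\<in>Xsp \<Omega>. \<forall>v0\<in>Xsp \<Omega>.
        Linf \<Omega> (\<lambda>x. u0 x - 1) + Linf \<Omega> v0 < \<eta> \<longrightarrow>
          (\<exists>u v. is_solution \<Omega> d1 d2 f \<kappa> \<gamma>1 \<gamma>2 u0 v0 u v) \<and>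
          (\<forall>u v. is_solution \<Omega> d1 d2 f \<kappa> \<gamma>1 \<gamma>2 u0 v0 u v \<longrightarrow>
             (\<forall>t\<ge>0. Linf \<Omega> (\<lambda>x. u t x - 1) + Linf \<Omega> (v t) < \<epsilon>))) \<and>
     (\<exists>\<eta>>0. \<forall>u0\<in>Xsp \<Omega>. \<forall>v0\<in>Xsp \<Omega>.
        Linf \<Omega> (\<lambda>x. u0 x - 1) + Linf \<Omega> v0 < \<eta> \<longrightarrow>
          (\<forall>u v. is_solution \<Omega> d1 d2 f \<kappa> \<gamma>1 \<gamma>2 u0 v0 u v \<longrightarrow>
             ((\<lambda>t. Linf \<Omega> (\<lambda>x. u t x - 1) + Linf \<Omega> (v t)) \<longlongrightarrow> 0) at_top))"

end

theory Submission
  imports Defs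
begin

text \<open>For every \<open>z\<close> the nonlocal term is \<open>\<integral>\<gamma>(x,y) z(y) dy - k(x) z(x)\<close> with
  \<open>k(x) = \<integral>\<gamma>(x,y) dy\<close> bounded, so an explicit Euler step shows that it never
  increases the sup norm. Hence a solution of \<open>z' = d \<Gamma> z - a z + g\<close> has
  upper right Dini derivative \<open>D\<^sup>+ \<parallel>z\<parallel> \<le> - inf a * \<parallel>z\<parallel> + \<parallel>g\<parallel>\<close>. Applied to
  \<open>u\<close> (\<open>a = f + v\<^sup>2\<close>, \<open>g = f\<close>), to \<open>v\<close> (\<open>a = f + \<kappa> - u v\<close>, \<open>g = 0\<close>) and to
  \<open>u - 1\<close> (\<open>a = f + v\<^sup>2\<close>, \<open>g = - v\<^sup>2\<close>), and compared with decaying exponentials, this gives all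
  bounds and the convergence. Existence for small data follows from
  Picard's theorem for a truncated, globally Lipschitz system on bounded Borel
  functions: the same estimates show that the truncation is never active.\<close>

section \<open>The seminorm of \<open>L\<^sub>\<infinity>\<close> along differentiable curves\<close>

text \<open>All estimates bound absolute values. Stability concerns every datum of
  \<open>Xsp\<close> near (1,0), including sign-changing ones, so no positivity of \<open>u\<close>
  or \<open>v\<close> may enter; and since the stability definition also demands a solution for each
  such datum, existence is proved for sign-changing data as well. A classical maximum principle
  would look at a point where |z(t)| is largest. Such points need not exist here: z(t) is fixed only
  up to null sets and is differentiable in time only in the norm of X. Hence the scalar function t
  -> \<open>Linf\<close> of z(t) is itself compared with a barrier. It need not be differentiable,
  and the comparison needs a strict inequality at each contact. This explains the slack everywhere:
  a level \<open>V\<close> strictly above the norm of \<open>v0\<close>, a rate \<open>r\<close>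
  equal to half of the available gap, a rate \<open>s\<close> of at most \<open>f / 2\<close>. The
  non-strict bounds come back as limits. The condition on \<open>v0\<close> says
  \<open>(1 + \<delta>) * Linf \<Omega> v0 < f + \<kappa>\<close>: as long as the bounds on
  \<open>u\<close> and \<open>v\<close> persist, the removal \<open>f + \<kappa>\<close> beats the
  production \<open>u * v\<close>. The barrier for \<open>v\<close> decreases, so it keeps doing
  so.\<close>

lemma Linf_le:
  assumes "0 \<le> C" "AE x in lebesgue_on \<Omega>. \<bar>z x\<bar> \<le> C"
  shows "Linf \<Omega> z \<le> C"
  unfolding Linf_def using assms by (intro cInf_lower bdd_belowI[of _ 0]) auto

text \<open>The infimum is attained: each bound \<open>Linf \<Omega> z + 1 / real (Suc n)\<close>
  fails only on a null set, and countably many null sets have a null union.\<close>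

lemma
  assumes "z \<in> Xsp \<Omega>"
  shows AE_abs_le_Linf: "AE x in lebesgue_on \<Omega>. \<bar>z x\<bar> \<le> Linf \<Omega> z"
    and Linf_nonneg: "0 \<le> Linf \<Omega> z"
proof -
  let ?S = "{C. 0 \<le> C \<and> (AE x in lebesgue_on \<Omega>. \<bar>z x\<bar> \<le> C)}"
  obtain C where C: "AE x in lebesgue_on \<Omega>. \<bar>z x\<bar> \<le> C"
    using assms by (auto simp: Xsp_def)
  have "AE x in lebesgue_on \<Omega>. \<bar>z x\<bar> \<le> max 0 C"
    using C by eventually_elim auto
  then have "max 0 C \<in> ?S"
    by simp
  then have ne: "?S \<noteq> {}"
    by blast
  then show "0 \<le> Linf \<Omega> z"
    unfolding Linf_def by (intro cInf_greatest) auto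
  have "AE x in lebesgue_on \<Omega>. \<bar>z x\<bar> \<le> Linf \<Omega> z + 1 / real (Suc n)" for n
  proof -
    have "Inf ?S < Linf \<Omega> z + 1 / real (Suc n)"
      by (simp add: Linf_def)
    then obtain D where "D \<in> ?S" "D < Linf \<Omega> z + 1 / real (Suc n)"
      using cInf_lessD[OF ne] by blast
    then show ?thesis
      by (auto elim!: eventually_mono)
  qed
  then have "AE x in lebesgue_on \<Omega>. \<forall>n. \<bar>z x\<bar> \<le> Linf \<Omega> z + 1 / real (Suc n)"
    by (simp add: AE_all_countable)
  then show "AE x in lebesgue_on \<Omega>. \<bar>z x\<bar> \<le> Linf \<Omega> z"
  proof eventually_elim
    case (elim x)
    show ?case
    proof (rule field_le_epsilon)
      fix e :: real assume "0 < e"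
      then obtain n where "inverse (real (Suc n)) < e"
        using reals_Archimedean by blast
      then show "\<bar>z x\<bar> \<le> Linf \<Omega> z + e"
        using elim[rule_format, of n] by (simp add: inverse_eq_divide)
    qed
  qed
qed

lemma Linf_cong_AE:
  assumes "AE x in lebesgue_on \<Omega>. z x = y x"
  shows "Linf \<Omega> z = Linf \<Omega> y"
proof -
  have "(AE x in lebesgue_on \<Omega>. \<bar>z x\<bar> \<le> C) \<longleftrightarrow> (AE x in lebesgue_on \<Omega>. \<bar>y x\<bar> \<le> C)" for C
  proof
    assume "AE x in lebesgue_on \<Omega>. \<bar>z x\<bar> \<le> C"
    with assms show "AE x in lebesgue_on \<Omega>. \<bar>y x\<bar> \<le> C"
      by eventually_elim auto
  next
    assume "AE x in lebesgue_on \<Omega>. \<bar>y x\<bar> \<le> C"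
    with assms show "AE x in lebesgue_on \<Omega>. \<bar>z x\<bar> \<le> C"
      by eventually_elim auto
  qed
  then show ?thesis
    by (simp add: Linf_def)
qed

section \<open>Closure properties of the space and the seminorm inequalities\<close>

lemma Xsp_const: "(\<lambda>x. c) \<in> Xsp \<Omega>"
  unfolding Xsp_def by (auto intro: AE_I2)

lemma Xsp_add:
  assumes "y \<in> Xsp \<Omega>" "z \<in> Xsp \<Omega>"
  shows "(\<lambda>x. y x + z x) \<in> Xsp \<Omega>"
proof -
  have "AE x in lebesgue_on \<Omega>. \<bar>y x + z x\<bar> \<le> Linf \<Omega> y + Linf \<Omega> z"
    using AE_abs_le_Linf[OF assms(1)] AE_abs_le_Linf[OF assms(2)] by eventually_elim linarith
  then show ?thesis
    using assms by (auto simp: Xsp_def)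
qed

lemma Xsp_cmult:
  assumes "z \<in> Xsp \<Omega>"
  shows "(\<lambda>x. c * z x) \<in> Xsp \<Omega>"
proof -
  have "AE x in lebesgue_on \<Omega>. \<bar>c * z x\<bar> \<le> \<bar>c\<bar> * Linf \<Omega> z"
    using AE_abs_le_Linf[OF assms] by eventually_elim (auto simp: abs_mult mult_left_mono)
  then show ?thesis
    using assms by (auto simp: Xsp_def)
qed

lemma Xsp_diff:
  assumes "y \<in> Xsp \<Omega>" "z \<in> Xsp \<Omega>"
  shows "(\<lambda>x. y x - z x) \<in> Xsp \<Omega>"
  using Xsp_add[OF assms(1) Xsp_cmult[OF assms(2), of "-1"]] by simp

lemma Linf_triangle:
  assumes "y \<in> Xsp \<Omega>" "z \<in> Xsp \<Omega>"
  shows "Linf \<Omega> (\<lambda>x. y x + z x) \<le> Linf \<Omega> y + Linf \<Omega> z"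
proof (rule Linf_le)
  show "0 \<le> Linf \<Omega> y + Linf \<Omega> z"
    using assms by (simp add: Linf_nonneg)
  show "AE x in lebesgue_on \<Omega>. \<bar>y x + z x\<bar> \<le> Linf \<Omega> y + Linf \<Omega> z"
    using AE_abs_le_Linf[OF assms(1)] AE_abs_le_Linf[OF assms(2)] by eventually_elim linarith
qed

lemma Linf_cmult_le:
  assumes "z \<in> Xsp \<Omega>"
  shows "Linf \<Omega> (\<lambda>x. c * z x) \<le> \<bar>c\<bar> * Linf \<Omega> z"
proof (rule Linf_le)
  show "0 \<le> \<bar>c\<bar> * Linf \<Omega> z"
    using assms by (simp add: Linf_nonneg)
  show "AE x in lebesgue_on \<Omega>. \<bar>c * z x\<bar> \<le> \<bar>c\<bar> * Linf \<Omega> z"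
    using AE_abs_le_Linf[OF assms] by eventually_elim (auto simp: abs_mult mult_left_mono)
qed

lemma AE_square_le:
  assumes "z \<in> Xsp \<Omega>" "Linf \<Omega> z \<le> b"
  shows "AE x in lebesgue_on \<Omega>. (z x)\<^sup>2 \<le> b\<^sup>2"
  using AE_abs_le_Linf[OF assms(1)]
proof eventually_elim
  case (elim x)
  then show ?case
    using assms(2) power_mono[of "\<bar>z x\<bar>" b 2] by simp
qed

text \<open>A small value of \<open>Linf\<close> controls pointwise values only for members of
  \<open>Xsp\<close>; elsewhere the infimum may run over the empty set.\<close>

lemma C1_X_quotient_Xsp:
  assumes "C1_X \<Omega> w W" "0 \<le> t" "0 \<le> t + h"
  shows "(\<lambda>x. (w (t + h) x - w t x) / h - W t x) \<in> Xsp \<Omega>"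
proof -
  have "w (t + h) \<in> Xsp \<Omega>" "w t \<in> Xsp \<Omega>" "W t \<in> Xsp \<Omega>"
    using assms by (auto simp: C1_X_def)
  then show ?thesis
    using Xsp_diff[OF Xsp_cmult[OF Xsp_diff, of "w (t + h)" \<Omega> "w t" "1 / h"], of "W t"] by simp
qed

text \<open>Near \<open>t\<close> the difference quotient is within 1 of \<open>W t\<close>, so the
  curve is Lipschitz at \<open>t\<close> with constant \<open>1 + Linf \<Omega> (W t)\<close>, and
  the norm inherits this by the triangle inequality.\<close>

lemma C1_X_continuous_Linf:
  assumes C1: "C1_X \<Omega> w W"
  shows "continuous_on {0..} (\<lambda>t. Linf \<Omega> (w t))"
  unfolding continuous_on_def
proof
  fix t :: real assume "t \<in> {0..}"
  then have t: "0 \<le> t" by simp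
  have mem: "w s \<in> Xsp \<Omega>" "W s \<in> Xsp \<Omega>" if "0 \<le> s" for s
    using C1 that by (auto simp: C1_X_def)
  have "((\<lambda>h. Linf \<Omega> (\<lambda>x. (w (t + h) x - w t x) / h - W t x)) \<longlongrightarrow> 0) (at 0 within {-t..})"
    using C1 t by (auto simp: C1_X_def)
  then have "\<forall>\<^sub>F h in at 0 within {-t..}. Linf \<Omega> (\<lambda>x. (w (t + h) x - w t x) / h - W t x) < 1"
    by (rule order_tendstoD) simp
  then obtain d where d: "0 < d" and
    q: "\<And>h. - t \<le> h \<Longrightarrow> h \<noteq> 0 \<Longrightarrow> \<bar>h\<bar> < d \<Longrightarrow> Linf \<Omega> (\<lambda>x. (w (t + h) x - w t x) / h - W t x) < 1"
    unfolding eventually_at by (auto simp: dist_real_def)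
  have bound: "\<bar>Linf \<Omega> (w s) - Linf \<Omega> (w t)\<bar> \<le> \<bar>s - t\<bar> * (1 + Linf \<Omega> (W t))"
    if s: "0 \<le> s" "s \<noteq> t" "\<bar>s - t\<bar> < d" for s
  proof -
    define e where "e = (\<lambda>x. (w s x - w t x) / (s - t) - W t x)"
    have e: "e \<in> Xsp \<Omega>"
      using C1_X_quotient_Xsp[OF C1 t, of "s - t"] s by (simp add: e_def)
    have "Linf \<Omega> e < 1"
      using q[of "s - t"] s by (simp add: e_def)
    moreover have "Linf \<Omega> (\<lambda>x. (s - t) * (e x + W t x)) \<le> \<bar>s - t\<bar> * (Linf \<Omega> e + Linf \<Omega> (W t))"
      using Linf_cmult_le[OF Xsp_add[OF e mem(2)[OF t]], of "s - t"] Linf_triangle[OF e mem(2)[OF t]]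
      by (meson abs_ge_zero mult_left_mono order_trans)
    moreover have "(s - t) * (e x + W t x) = w s x - w t x" for x
      using s by (simp add: e_def)
    moreover have "\<bar>s - t\<bar> * (Linf \<Omega> e + Linf \<Omega> (W t)) \<le> \<bar>s - t\<bar> * (1 + Linf \<Omega> (W t))"
      using \<open>Linf \<Omega> e < 1\<close> by (intro mult_left_mono) auto
    ultimately have D: "Linf \<Omega> (\<lambda>x. w s x - w t x) \<le> \<bar>s - t\<bar> * (1 + Linf \<Omega> (W t))"
      by simp
    have D': "Linf \<Omega> (\<lambda>x. w t x - w s x) \<le> Linf \<Omega> (\<lambda>x. w s x - w t x)"
      using Linf_cmult_le[OF Xsp_diff[OF mem(1)[OF s(1)] mem(1)[OF t]], of "-1"] by simp
    have "Linf \<Omega> (w s) \<le> Linf \<Omega> (w t) + Linf \<Omega> (\<lambda>x. w s x - w t x)"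
      using Linf_triangle[OF mem(1)[OF t] Xsp_diff[OF mem(1)[OF s(1)] mem(1)[OF t]]] by simp
    moreover have "Linf \<Omega> (w t) \<le> Linf \<Omega> (w s) + Linf \<Omega> (\<lambda>x. w t x - w s x)"
      using Linf_triangle[OF mem(1)[OF s(1)] Xsp_diff[OF mem(1)[OF t] mem(1)[OF s(1)]]] by simp
    ultimately show ?thesis
      using D D' by linarith
  qed
  have lim: "((\<lambda>s. \<bar>s - t\<bar> * (1 + Linf \<Omega> (W t))) \<longlongrightarrow> 0) (at t within {0..})"
    by (rule tendsto_eq_intros refl)+ simp
  have "((\<lambda>s. Linf \<Omega> (w s) - Linf \<Omega> (w t)) \<longlongrightarrow> 0) (at t within {0..})"
  proof (rule Lim_null_comparison[OF _ lim])
    show "\<forall>\<^sub>F s in at t within {0..}. norm (Linf \<Omega> (w s) - Linf \<Omega> (w t)) \<le> \<bar>s - t\<bar> * (1 + Linf \<Omega> (W t))"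
      unfolding eventually_at using d bound by (auto simp: dist_real_def)
  qed
  then show "((\<lambda>s. Linf \<Omega> (w s)) \<longlongrightarrow> Linf \<Omega> (w t)) (at t within {0..})"
    by (simp add: LIM_zero_iff)
qed

text \<open>Only this property of the kernel enters the estimates; the witness is
  \<open>k = \<integral>\<gamma>(x,y) dy\<close>, and the exceptional null set may depend on \<open>z\<close>.\<close>

definition diffusive :: "(real ^ 'n) set \<Rightarrow> (real ^ 'n \<Rightarrow> real ^ 'n \<Rightarrow> real) \<Rightarrow> real \<Rightarrow> bool" where
  "diffusive \<Omega> \<gamma> C \<longleftrightarrow> (\<forall>z\<in>Xsp \<Omega>. AE x in lebesgue_on \<Omega>.
     \<exists>k. 0 \<le> k \<and> k \<le> C \<and> \<bar>Gam \<Omega> \<gamma> z x + k * z x\<bar> \<le> k * Linf \<Omega> z)"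

text \<open>In one Euler step the old value gets the factor \<open>1 - h * (a x + d * k)\<close>.
  Once this is nonnegative, the loss \<open>h * d * k * N\<close> in the first term cancels the gain
  allowed to the nonlocal term, and the diffusion leaves no trace in the bound. The upper bound
  \<open>A\<close> makes the admissible \<open>h\<close> uniform in \<open>x\<close>.\<close>

lemma C1_X_Dini:
  assumes C1: "C1_X \<Omega> w W" and diff: "diffusive \<Omega> \<gamma> C" "0 \<le> C" and t: "0 \<le> t" and d: "0 \<le> d"
    and W: "AE x in lebesgue_on \<Omega>. W t x = d * Gam \<Omega> \<gamma> (w t) x - a x * w t x + g x"
    and a: "AE x in lebesgue_on \<Omega>. \<alpha> \<le> a x \<and> a x \<le> A"
    and g: "AE x in lebesgue_on \<Omega>. \<bar>g x\<bar> \<le> \<beta>" "0 \<le> \<beta>"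
    and b: "\<beta> - \<alpha> * Linf \<Omega> (w t) < b"
  shows "\<forall>\<^sub>F h in at_right 0. Linf \<Omega> (w (t + h)) \<le> Linf \<Omega> (w t) + h * b"
proof -
  define N where "N = Linf \<Omega> (w t)"
  \<comment> \<open>The gap between \<open>b\<close> and the formal growth rate; it absorbs the
    error of the difference quotient.\<close>
  define \<epsilon> where "\<epsilon> = b - (\<beta> - \<alpha> * N)"
  have wX: "w s \<in> Xsp \<Omega>" if "0 \<le> s" for s
    using C1 that by (auto simp: C1_X_def)
  have N: "0 \<le> N"
    using wX[OF t] by (simp add: N_def Linf_nonneg)
  have eps: "0 < \<epsilon>"
    using b by (simp add: \<epsilon>_def N_def)
  have lim: "((\<lambda>h. Linf \<Omega> (\<lambda>x. (w (t + h) x - w t x) / h - W t x)) \<longlongrightarrow> 0) (at 0 within {-t..})"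
    using C1 t by (auto simp: C1_X_def)
  have "at_right 0 \<le> at (0::real) within {-t..}"
    using t by (intro at_le) auto
  then have "((\<lambda>h. Linf \<Omega> (\<lambda>x. (w (t + h) x - w t x) / h - W t x)) \<longlongrightarrow> 0) (at_right 0)"
    using lim by (rule tendsto_mono)
  then have e1: "\<forall>\<^sub>F h in at_right 0. Linf \<Omega> (\<lambda>x. (w (t + h) x - w t x) / h - W t x) < \<epsilon>"
    using eps by (rule order_tendstoD)
  \<comment> \<open>Dominates both \<open>a x + d * k\<close> and \<open>\<alpha>\<close>; the
    summand 1 keeps it positive, so that \<open>1 / K\<close> is a valid step bound.\<close>
  define K where "K = \<bar>A\<bar> + \<bar>\<alpha>\<bar> + d * C + 1"
  have K: "0 < K"
    using d diff by (simp add: K_def add_nonneg_pos)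
  have e2: "\<forall>\<^sub>F h in at_right 0. 0 < h \<and> h < 1 / K"
    using K by (auto simp: eventually_at_right_field intro!: exI[of _ "1 / K"])
  show ?thesis
    using e1 e2
  proof eventually_elim
    case (elim h)
    define e where "e = (\<lambda>x. (w (t + h) x - w t x) / h - W t x)"
    have h: "0 < h" "h * K < 1"
      using elim K by (auto simp: field_simps)
    have e: "e \<in> Xsp \<Omega>"
      using C1_X_quotient_Xsp[OF C1 t, of h] t h by (simp add: e_def)
    have small: "h * y < 1" if "y \<le> K" for y
      using that h by (meson mult_left_mono less_imp_le order_le_less_trans)
    have kernel: "AE x in lebesgue_on \<Omega>.
        \<exists>k. 0 \<le> k \<and> k \<le> C \<and> \<bar>Gam \<Omega> \<gamma> (w t) x + k * w t x\<bar> \<le> k * N"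
      using diff wX[OF t] by (simp add: diffusive_def N_def)
    have main: "AE x in lebesgue_on \<Omega>. \<bar>w (t + h) x\<bar> \<le> N + h * b"
      using AE_abs_le_Linf[OF e] AE_abs_le_Linf[OF wX[OF t]] kernel W a g(1)
    proof eventually_elim
      case (elim x)
      then obtain k where k: "0 \<le> k" "k \<le> C" "\<bar>Gam \<Omega> \<gamma> (w t) x + k * w t x\<bar> \<le> k * N"
        by blast
      have dk: "0 \<le> d * k" "d * k \<le> d * C"
        using k d by (auto simp: mult_left_mono)
      have "h * (a x + d * k) < 1"
        using elim dk by (intro small) (auto simp: K_def)
      then have c: "0 \<le> 1 - h * (a x + d * k)"
        by simp
      have "\<bar>e x\<bar> \<le> \<epsilon>"
        using elim \<open>Linf \<Omega> (\<lambda>x. (w (t + h) x - w t x) / h - W t x) < \<epsilon>\<close> by (simp add: e_def)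
      then have ee: "\<bar>h * e x\<bar> \<le> h * \<epsilon>"
        using h by (simp add: abs_mult)
      have gg: "\<bar>h * g x\<bar> \<le> h * \<beta>"
        using elim h by (simp add: abs_mult)
      have kk: "\<bar>h * d * (Gam \<Omega> \<gamma> (w t) x + k * w t x)\<bar> \<le> h * d * (k * N)"
        using k d h by (simp add: abs_mult mult_left_mono)
      have ww: "\<bar>(1 - h * (a x + d * k)) * w t x\<bar> \<le> (1 - h * (a x + d * k)) * N"
        using c elim by (simp add: abs_mult N_def mult_left_mono)
      have "w (t + h) x = w t x + h * W t x + h * e x"
        using h by (simp add: e_def field_simps)
      also have "\<dots> = (1 - h * (a x + d * k)) * w t x
          + h * d * (Gam \<Omega> \<gamma> (w t) x + k * w t x) + h * g x + h * e x"
        unfolding elim(4) by (simp add: algebra_simps)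
      finally have "\<bar>w (t + h) x\<bar> \<le> (1 - h * (a x + d * k)) * N + h * d * (k * N) + h * \<beta> + h * \<epsilon>"
        using ww kk gg ee by linarith
      also have "\<dots> = N - h * N * a x + h * \<beta> + h * \<epsilon>"
        by (simp add: algebra_simps)
      also have "\<dots> \<le> N - h * N * \<alpha> + h * \<beta> + h * \<epsilon>"
        using elim h N by (simp add: mult_left_mono)
      also have "\<dots> = N + h * b"
        by (simp add: \<epsilon>_def algebra_simps)
      finally show ?case .
    qed
    \<comment> \<open>\<open>Linf_le\<close> asks for a nonnegative bound, and \<open>b\<close> may
      be negative; a step with \<open>h * \<alpha> < 1\<close> cannot push the bound below
      zero.\<close>
    have "h * \<alpha> < 1"
      using mult_nonneg_nonneg[OF d diff(2)] by (intro small) (simp add: K_def)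
    then have "0 \<le> (1 - h * \<alpha>) * N + h * \<beta> + h * \<epsilon>"
      using N h g eps by simp
    also have "\<dots> = N + h * b"
      by (simp add: \<epsilon>_def algebra_simps)
    finally show ?case
      using main unfolding N_def by (rule Linf_le)
  qed
qed

text \<open>If the barrier is exceeded at \<open>T\<close>, consider the last earlier time at which
  it is not. There the two functions meet, and just afterwards \<open>\<phi>\<close> lies above
  \<open>m\<close> although it grows at most at a rate \<open>b\<close> below the slope of
  \<open>m\<close>.\<close>

lemma barrier_comparison:
  fixes \<phi> m m' :: "real \<Rightarrow> real"
  assumes cont: "continuous_on {0..} \<phi>"
    and m: "\<And>t. 0 \<le> t \<Longrightarrow> (m has_real_derivative m' t) (at t)"
    and init: "\<phi> 0 \<le> m 0"
    and touch: "\<And>t. 0 \<le> t \<Longrightarrow> \<phi> t = m t \<Longrightarrow>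
      \<exists>b<m' t. \<forall>\<^sub>F h in at_right 0. \<phi> (t + h) \<le> \<phi> t + h * b"
    and T: "0 \<le> T"
  shows "\<phi> T \<le> m T"
proof (rule ccontr)
  assume "\<not> \<phi> T \<le> m T"
  then have gt: "m T < \<phi> T" by simp
  define S where "S = {t \<in> {0..T}. \<phi> t \<le> m t}"
  have contm: "continuous_on {0..T} m"
    using m by (meson DERIV_isCont atLeastAtMost_iff continuous_at_imp_continuous_on)
  have cont\<phi>: "continuous_on {0..T} \<phi>"
    using cont by (rule continuous_on_subset) auto
  have "closed S"
    using contm cont\<phi> unfolding S_def by (intro continuous_on_closed_Collect_le) auto
  moreover have "bounded S"
    by (rule bounded_subset[OF bounded_closed_interval[of 0 T]]) (auto simp: S_def)
  ultimately have "compact S"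
    by (simp add: compact_eq_bounded_closed)
  moreover have "S \<noteq> {}"
    using init T by (auto simp: S_def)
  ultimately obtain s where s: "s \<in> S" "\<And>t. t \<in> S \<Longrightarrow> t \<le> s"
    using compact_attains_sup[of S] by blast
  have sT: "0 \<le> s" "s < T"
    using s(1) gt by (auto simp: S_def less_le)
  have above: "m t < \<phi> t" if "s < t" "t \<le> T" for t
  proof -
    have "t \<notin> S"
      using s(2)[of t] that by auto
    then show ?thesis
      using that sT by (auto simp: S_def)
  qed
  have ev: "\<forall>\<^sub>F h in at_right 0. 0 < h \<and> m (s + h) < \<phi> (s + h)"
    unfolding eventually_at_right_field using sT above by (intro exI[of _ "T - s"]) auto
  \<comment> \<open>Continuity from the right turns the strict excess after \<open>s\<close> into
    equality at \<open>s\<close>, which is what \<open>touch\<close> requires.\<close>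
  have "m s \<le> \<phi> s"
  proof (rule tendsto_le)
    show "at_right s \<noteq> bot" by simp
    have sub: "at_right s = at s within {s<..T}"
      using sT by (intro at_within_nhd[of _ "{..<T}"]) auto
    show "(\<phi> \<longlongrightarrow> \<phi> s) (at_right s)"
      unfolding sub
      by (rule tendsto_within_subset[of \<phi> _ s "{0..T}"]) (use cont\<phi> sT in \<open>auto simp: continuous_on_def\<close>)
    show "(m \<longlongrightarrow> m s) (at_right s)"
      unfolding sub
      by (rule tendsto_within_subset[of m _ s "{0..T}"]) (use contm sT in \<open>auto simp: continuous_on_def\<close>)
    show "\<forall>\<^sub>F t in at_right s. m t \<le> \<phi> t"
      unfolding eventually_at_right_field using sT above
      by (intro exI[of _ T]) (auto intro: less_imp_le)
  qed
  then have eq: "\<phi> s = m s"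
    using s(1) by (simp add: S_def)
  obtain b where b: "b < m' s" "\<forall>\<^sub>F h in at_right 0. \<phi> (s + h) \<le> \<phi> s + h * b"
    using touch[OF sT(1) eq] by blast
  have "((\<lambda>h. (m (s + h) - m s) / h) \<longlongrightarrow> m' s) (at 0)"
    using m[OF sT(1)] by (simp add: DERIV_def)
  then have "((\<lambda>h. (m (s + h) - m s) / h) \<longlongrightarrow> m' s) (at_right 0)"
    by (rule tendsto_mono[OF at_le, rotated]) simp
  then have "\<forall>\<^sub>F h in at_right 0. b < (m (s + h) - m s) / h"
    using b(1) by (rule order_tendstoD)
  then have "\<forall>\<^sub>F h in at_right (0::real). False"
    using b(2) ev
  proof eventually_elim
    case (elim h)
    then have "b * h < m (s + h) - m s"
      by (simp add: pos_less_divide_eq)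
    with elim eq show False
      by (simp add: mult.commute)
  qed
  then show False
    by (simp add: eventually_False trivial_limit_at_right_real)
qed

section \<open>Kernels\<close>

text \<open>The sections of a Lebesgue measurable kernel are measurable only for almost every
  \<open>x\<close>. Passing to a Borel version avoids the bad points.\<close>

definition borel_kernel :: "((real ^ 'n) \<times> (real ^ 'n) \<Rightarrow> real) \<Rightarrow> real \<Rightarrow> bool" where
  "borel_kernel g C \<longleftrightarrow> g \<in> borel_measurable borel \<and> (\<forall>p. 0 \<le> g p) \<and>
     (\<forall>x. (\<integral>\<^sup>+ y. ennreal (g (x, y)) \<partial>lborel) \<le> ennreal C)"

text \<open>Sections are extended by zero, so that integrals over \<open>\<Omega>\<close> become
  integrals over the whole space.\<close>

definition kernel_version ::
    "(real ^ 'n) set \<Rightarrow> (real ^ 'n \<Rightarrow> real ^ 'n \<Rightarrow> real) \<Rightarrow> ((real ^ 'n) \<times> (real ^ 'n) \<Rightarrow> real) \<Rightarrow> bool" where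
  "kernel_version \<Omega> \<gamma> g \<longleftrightarrow>
     (AE x in lebesgue_on \<Omega>. AE y in lborel. g (x, y) = (if y \<in> \<Omega> then \<gamma> x y else 0))"

lemma AE_lborel_imp_lebesgue_on:
  assumes "\<Omega> \<in> sets lebesgue" "AE x in lborel. x \<in> \<Omega> \<longrightarrow> P x"
  shows "AE x in lebesgue_on \<Omega>. P x"
  using assms by (simp add: AE_restrict_space_iff AE_completion)

text \<open>A Borel function equal to the zero extension of the kernel a.e. on the product has, by
  Fubini, the right sections for almost every \<open>x\<close>. Nonnegativity and the mass bound may
  fail on the remaining sections and are enforced by hand.\<close>

lemma borel_kernel_version_exists:
  fixes \<gamma> :: "real ^ 'n \<Rightarrow> real ^ 'n \<Rightarrow> real"
  assumes \<Omega>: "open \<Omega>"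
    and meas: "(\<lambda>(x, y). \<gamma> x y) \<in> borel_measurable (lebesgue_on (\<Omega> \<times> \<Omega>))"
    and nn: "\<And>x y. x \<in> \<Omega> \<Longrightarrow> y \<in> \<Omega> \<Longrightarrow> 0 \<le> \<gamma> x y"
    and bd: "\<And>x. x \<in> \<Omega> \<Longrightarrow> (\<integral>\<^sup>+ y. ennreal (\<gamma> x y) \<partial>lebesgue_on \<Omega>) \<le> ennreal C"
  obtains g where "borel_kernel g C" "kernel_version \<Omega> \<gamma> g"
proof -
  define G where "G = (\<lambda>p. if p \<in> \<Omega> \<times> \<Omega> then case p of (x, y) \<Rightarrow> \<gamma> x y else 0)"
  have \<Omega>leb: "\<Omega> \<in> sets lebesgue"
    using \<Omega> by auto
  have "open (\<Omega> \<times> \<Omega>)"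
    using \<Omega> by (simp add: open_Times)
  then have "\<Omega> \<times> \<Omega> \<in> sets lebesgue"
    by auto
  then have "G \<in> borel_measurable lebesgue"
    unfolding G_def by (rule borel_measurable_if_I[OF meas])
  then obtain g0 where g0: "g0 \<in> borel_measurable lborel" and G: "AE p in lborel. G p = g0 p"
    using completion_ex_borel_measurable_real by blast
  have g0' [measurable]: "g0 \<in> borel_measurable (borel \<Otimes>\<^sub>M borel)"
    using g0 by (simp add: borel_prod)
  have sec: "AE x in lborel. AE y in lborel. G (x, y) = g0 (x, y)"
    using G unfolding lborel_prod[symmetric] by (rule lborel_pair.AE_pair)
  define k where "k x = (\<integral>\<^sup>+ y. ennreal (g0 (x, y)) \<partial>lborel)" for x
  have [measurable]: "k \<in> borel_measurable borel"
    unfolding k_def by measurable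
  \<comment> \<open>Sections of too large mass are replaced by zero, which keeps \<open>g\<close>
    Borel because \<open>k\<close> is. For almost every \<open>x\<close> in \<open>\<Omega>\<close>
    neither this nor the positive part changes the section, by \<open>bd\<close> and
    \<open>nn\<close>.\<close>
  define g where "g p = (if k (fst p) \<le> ennreal C then max 0 (g0 p) else 0)" for p
  have max0: "ennreal (max 0 a) = ennreal a" for a
    by (simp add: max_def ennreal_neg)
  have "g \<in> borel_measurable (borel \<Otimes>\<^sub>M borel)"
    unfolding g_def by measurable
  moreover have "(\<integral>\<^sup>+ y. ennreal (g (x, y)) \<partial>lborel) \<le> ennreal C" for x
    by (cases "k x \<le> ennreal C") (auto simp: g_def max0 k_def)
  ultimately have "borel_kernel g C"
    by (auto simp: borel_kernel_def borel_prod g_def)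
  moreover have "kernel_version \<Omega> \<gamma> g"
    unfolding kernel_version_def
  proof (rule AE_lborel_imp_lebesgue_on[OF \<Omega>leb])
    show "AE x in lborel. x \<in> \<Omega> \<longrightarrow> (AE y in lborel. g (x, y) = (if y \<in> \<Omega> then \<gamma> x y else 0))"
      using sec
    proof eventually_elim
      case (elim x)
      show ?case
      proof
        assume x: "x \<in> \<Omega>"
        have "k x = (\<integral>\<^sup>+ y. ennreal (G (x, y)) \<partial>lborel)"
          unfolding k_def using elim by (intro nn_integral_cong_AE) (auto elim!: eventually_mono)
        also have "\<dots> = (\<integral>\<^sup>+ y. ennreal (\<gamma> x y) * indicator \<Omega> y \<partial>lebesgue)"
          using x by (auto simp: nn_integral_completion G_def indicator_def intro!: nn_integral_cong)
        also have "\<dots> = (\<integral>\<^sup>+ y. ennreal (\<gamma> x y) \<partial>lebesgue_on \<Omega>)"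
          using \<Omega>leb by (simp add: nn_integral_restrict_space)
        finally have kC: "k x \<le> ennreal C"
          using bd[OF x] by simp
        show "AE y in lborel. g (x, y) = (if y \<in> \<Omega> then \<gamma> x y else 0)"
          using elim
        proof eventually_elim
          case (elim y)
          then show ?case
            using x nn[OF x, of y] kC by (auto simp: g_def G_def)
        qed
      qed
    qed
  qed
  ultimately show thesis ..
qed

lemma borel_kernel_section:
  assumes "borel_kernel g C"
  shows borel_kernel_measurable: "(\<lambda>y. g (x, y)) \<in> borel_measurable borel"
    and borel_kernel_integrable: "integrable lborel (\<lambda>y. g (x, y))"
    and borel_kernel_integral_nonneg: "0 \<le> (LINT y|lborel. g (x, y))"
    and borel_kernel_integral_le: "0 \<le> C \<Longrightarrow> (LINT y|lborel. g (x, y)) \<le> C"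
proof -
  have g: "g \<in> borel_measurable (borel \<Otimes>\<^sub>M borel)" "\<And>p. 0 \<le> g p"
    and bd: "(\<integral>\<^sup>+ y. ennreal (g (x, y)) \<partial>lborel) \<le> ennreal C"
    using assms by (auto simp: borel_kernel_def borel_prod)
  note [measurable] = g(1)
  show m: "(\<lambda>y. g (x, y)) \<in> borel_measurable borel"
    by measurable
  have "(\<integral>\<^sup>+ y. ennreal (norm (g (x, y))) \<partial>lborel) < \<infinity>"
    using bd g(2) by (simp add: order_le_less_trans[OF _ ennreal_less_top])
  then show i: "integrable lborel (\<lambda>y. g (x, y))"
    using m by (intro integrableI_bounded) auto
  show n: "0 \<le> (LINT y|lborel. g (x, y))"
    using g(2) by simp
  show "(LINT y|lborel. g (x, y)) \<le> C" if "0 \<le> C"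
    using bd nn_integral_eq_integral[OF i] g(2) that by (simp add: ennreal_le_iff)
qed

text \<open>The exceptional set comes from the kernel alone, so one null set serves all
  \<open>z\<close>. The integral is over \<open>lebesgue\<close>, since \<open>z\<close> need not be
  Borel.\<close>

lemma Gam_kernel_version:
  assumes \<Omega>: "\<Omega> \<in> sets lebesgue" and g: "borel_kernel g C" "kernel_version \<Omega> \<gamma> g"
  shows "AE x in lebesgue_on \<Omega>. \<forall>z\<in>borel_measurable (lebesgue_on \<Omega>).
    Gam \<Omega> \<gamma> z x = (LINT y|lebesgue. g (x, y) * ((if y \<in> \<Omega> then z y else 0) - z x))"
  using g(2) unfolding kernel_version_def
proof eventually_elim
  case (elim x)
  show ?case
  proof
    fix z :: "real ^ 'a \<Rightarrow> real"
    assume "z \<in> borel_measurable (lebesgue_on \<Omega>)"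
    then have z: "(\<lambda>y. if y \<in> \<Omega> then z y else 0) \<in> borel_measurable lebesgue"
      using \<Omega> by (rule borel_measurable_if_I)
    have gx: "(\<lambda>y. g (x, y)) \<in> borel_measurable lebesgue"
      using borel_kernel_measurable[OF g(1)] by (intro measurable_completion) simp
    have r: "(\<lambda>y. g (x, y) * ((if y \<in> \<Omega> then z y else 0) - z x)) \<in> borel_measurable lebesgue"
      using z gx by measurable
    have eq: "AE y in lebesgue. g (x, y) * ((if y \<in> \<Omega> then z y else 0) - z x)
        = (if y \<in> \<Omega> then \<gamma> x y * (z y - z x) else 0)"
      using AE_completion[OF elim] by eventually_elim auto
    have "Gam \<Omega> \<gamma> z x = (LINT y|lebesgue. (if y \<in> \<Omega> then \<gamma> x y * (z y - z x) else 0))"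
      unfolding Gam_def by (rule Lebesgue_Measure.integral_restrict_UNIV[OF \<Omega>, symmetric])
    \<comment> \<open>Measurability of the integrand with \<gamma> is inherited from the one with
      \<open>g\<close> through a.e. equality and completeness.\<close>
    also have "\<dots> = (LINT y|lebesgue. g (x, y) * ((if y \<in> \<Omega> then z y else 0) - z x))"
      by (rule integral_cong_AE[OF r borel_measurable_AE[OF r eq] eq, symmetric])
    finally show "Gam \<Omega> \<gamma> z x = (LINT y|lebesgue. g (x, y) * ((if y \<in> \<Omega> then z y else 0) - z x))" .
  qed
qed

text \<open>With \<open>k\<close> the mass of the section, adding \<open>k * z x\<close> leaves the
  integral of \<open>z\<close> against a nonnegative kernel of mass \<open>k\<close>. Integrability
  of the section is what permits splitting the integral.\<close>

lemma diffusive_kernel_version: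
  assumes \<Omega>: "\<Omega> \<in> sets lebesgue" and g: "borel_kernel g C" "kernel_version \<Omega> \<gamma> g" and C: "0 \<le> C"
  shows "diffusive \<Omega> \<gamma> C"
  unfolding diffusive_def
proof
  fix z assume z: "z \<in> Xsp \<Omega>"
  then have zm: "z \<in> borel_measurable (lebesgue_on \<Omega>)"
    by (simp add: Xsp_def)
  define N where "N = Linf \<Omega> z"
  have N: "0 \<le> N"
    using Linf_nonneg[OF z] by (simp add: N_def)
  define y where "y x = (if x \<in> \<Omega> then z x else 0)" for x
  have ym: "y \<in> borel_measurable lebesgue"
    unfolding y_def using zm \<Omega> by (rule borel_measurable_if_I)
  have yN: "AE x in lebesgue. \<bar>y x\<bar> \<le> N"
    using AE_abs_le_Linf[OF z] N \<Omega> by (auto simp: AE_restrict_space_iff y_def N_def elim!: eventually_mono)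
  show "AE x in lebesgue_on \<Omega>. \<exists>k\<ge>0. k \<le> C \<and> \<bar>Gam \<Omega> \<gamma> z x + k * z x\<bar> \<le> k * Linf \<Omega> z"
    using Gam_kernel_version[OF \<Omega> g]
  proof eventually_elim
    case (elim x)
    define h where "h = (\<lambda>y. g (x, y))"
    have h: "h \<in> borel_measurable lborel" "integrable lborel h" "\<And>y. 0 \<le> h y"
      using g(1) borel_kernel_measurable[OF g(1)] borel_kernel_integrable[OF g(1)]
      by (auto simp: h_def borel_kernel_def)
    have hm: "h \<in> borel_measurable lebesgue" and hi: "integrable lebesgue h"
      using h by (auto simp: integrable_completion intro: measurable_completion)
    define k where "k = (LINT y|lebesgue. h y)"
    have "k = (LINT y|lborel. h y)"
      unfolding k_def using h(1) by (rule integral_completion)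
    then have k: "0 \<le> k" "k \<le> C"
      using borel_kernel_integral_nonneg[OF g(1)] borel_kernel_integral_le[OF g(1) C] by (auto simp: h_def)
    have hN: "integrable lebesgue (\<lambda>t. h t * N)"
      using hi by simp
    have bound: "AE t in lebesgue. norm (h t * y t) \<le> h t * N"
      using yN by eventually_elim (auto simp: abs_mult h(3) mult_left_mono)
    have hy: "integrable lebesgue (\<lambda>t. h t * y t)"
    proof (rule Bochner_Integration.integrable_bound[OF hN])
      show "(\<lambda>t. h t * y t) \<in> borel_measurable lebesgue"
        using hm ym by measurable
      show "AE t in lebesgue. norm (h t * y t) \<le> norm (h t * N)"
        using bound by eventually_elim auto
    qed
    have "Gam \<Omega> \<gamma> z x = (LINT t|lebesgue. h t * y t - h t * z x)"
      using elim zm by (simp add: h_def y_def algebra_simps)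
    also have "\<dots> = (LINT t|lebesgue. h t * y t) - k * z x"
      using hy hi by (simp add: k_def)
    finally have "\<bar>Gam \<Omega> \<gamma> z x + k * z x\<bar> = norm (LINT t|lebesgue. h t * y t)"
      by simp
    also have "\<dots> \<le> (LINT t|lebesgue. h t * N)"
      using bound by (intro order_trans[OF integral_norm_bound] integral_mono_AE integrable_norm hy hN)
    also have "\<dots> = k * N"
      by (simp add: k_def)
    finally show ?case
      using k by (auto simp: N_def)
  qed
qed

section \<open>A priori bounds\<close>

text \<open>The coefficients are chosen afresh at each contact time, where the norm is known to
  equal \<open>m t\<close>. A nonlinear term can thus be frozen into \<open>a\<close> or
  \<open>g\<close> and bounded by the barrier itself.\<close>

lemma C1_X_le_barrier:
  assumes C1: "C1_X \<Omega> w W" and diff: "diffusive \<Omega> \<gamma> C" "0 \<le> C" and d: "0 \<le> d"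
    and m: "\<And>t. 0 \<le> t \<Longrightarrow> (m has_real_derivative m' t) (at t)"
    and init: "Linf \<Omega> (w 0) \<le> m 0"
    and touch: "\<And>t. 0 \<le> t \<Longrightarrow> Linf \<Omega> (w t) = m t \<Longrightarrow> \<exists>a g \<alpha> A \<beta>.
      (AE x in lebesgue_on \<Omega>. W t x = d * Gam \<Omega> \<gamma> (w t) x - a x * w t x + g x) \<and>
      (AE x in lebesgue_on \<Omega>. \<alpha> \<le> a x \<and> a x \<le> A) \<and>
      (AE x in lebesgue_on \<Omega>. \<bar>g x\<bar> \<le> \<beta>) \<and> 0 \<le> \<beta> \<and> \<beta> - \<alpha> * m t < m' t"
    and t: "0 \<le> t"
  shows "Linf \<Omega> (w t) \<le> m t"
proof (rule barrier_comparison[OF C1_X_continuous_Linf[OF C1] m init _ t])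
  fix t assume t: "0 \<le> t" and eq: "Linf \<Omega> (w t) = m t"
  obtain a g \<alpha> A \<beta> where *:
      "AE x in lebesgue_on \<Omega>. W t x = d * Gam \<Omega> \<gamma> (w t) x - a x * w t x + g x"
      "AE x in lebesgue_on \<Omega>. \<alpha> \<le> a x \<and> a x \<le> A"
      "AE x in lebesgue_on \<Omega>. \<bar>g x\<bar> \<le> \<beta>" "0 \<le> \<beta>"
    and lt: "\<beta> - \<alpha> * m t < m' t"
    using touch[OF t eq] by (elim exE conjE) (rule that; assumption)
  obtain b where "\<beta> - \<alpha> * m t < b" "b < m' t"
    using dense[OF lt] by blast
  then show "\<exists>b<m' t. \<forall>\<^sub>F h in at_right 0. Linf \<Omega> (w (t + h)) \<le> Linf \<Omega> (w t) + h * b"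
    using C1_X_Dini[OF C1 diff t d *, of b] eq by auto
qed

text \<open>At a level above 1 the damping, at least \<open>f\<close> times the level, exceeds the
  source \<open>f\<close>. At \<open>U = 1\<close> they may balance, hence the barrier
  \<open>U + e\<close>. The derivative \<open>W\<close> is left abstract so that the truncated
  system is covered too.\<close>

lemma Linf_substrate_le:
  assumes C1: "C1_X \<Omega> u W" and diff: "diffusive \<Omega> \<gamma> C" "0 \<le> C" and d: "0 \<le> d" and f: "0 < f"
    and W: "\<And>t. 0 \<le> t \<Longrightarrow> \<exists>a A. (AE x in lebesgue_on \<Omega>. W t x = d * Gam \<Omega> \<gamma> (u t) x - a x * u t x + f) \<and>
      (AE x in lebesgue_on \<Omega>. f \<le> a x \<and> a x \<le> A)"
    and U: "1 \<le> U" "Linf \<Omega> (u 0) \<le> U" and t: "0 \<le> t"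
  shows "Linf \<Omega> (u t) \<le> U"
proof (rule field_le_epsilon)
  fix e :: real assume e: "0 < e"
  show "Linf \<Omega> (u t) \<le> U + e"
  proof (rule C1_X_le_barrier[OF C1 diff d, where m = "\<lambda>t. U + e" and m' = "\<lambda>t. 0"])
    fix t :: real assume "0 \<le> t"
    then obtain a A where
      "AE x in lebesgue_on \<Omega>. W t x = d * Gam \<Omega> \<gamma> (u t) x - a x * u t x + f"
      "AE x in lebesgue_on \<Omega>. f \<le> a x \<and> a x \<le> A"
      using W by blast
    moreover have "f - f * (U + e) < 0"
    proof -
      have "f * 1 < f * (U + e)"
        using f U e by (intro mult_strict_left_mono) auto
      then show ?thesis by simp
    qed
    ultimately show "\<exists>a g \<alpha> A \<beta>.
      (AE x in lebesgue_on \<Omega>. W t x = d * Gam \<Omega> \<gamma> (u t) x - a x * u t x + g x) \<and>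
      (AE x in lebesgue_on \<Omega>. \<alpha> \<le> a x \<and> a x \<le> A) \<and>
      (AE x in lebesgue_on \<Omega>. \<bar>g x\<bar> \<le> \<beta>) \<and> 0 \<le> \<beta> \<and> \<beta> - \<alpha> * (U + e) < 0"
      using f by (intro exI[of _ a] exI[of _ "\<lambda>x. f"] exI[of _ f] exI[of _ A]) auto
  qed (use U e t in auto)
qed

lemma C1_X_diff_const:
  assumes "C1_X \<Omega> w W"
  shows "C1_X \<Omega> (\<lambda>t x. w t x - c) W"
  using assms Xsp_diff[OF _ Xsp_const] unfolding C1_X_def by auto

section \<open>Bounds for an arbitrary solution of the system\<close>

context
  fixes \<Omega> :: "(real ^ 'n) set" and d1 d2 f \<kappa> C :: real and \<gamma>1 \<gamma>2 u0 v0 u v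
  assumes diff: "diffusive \<Omega> \<gamma>1 C" "diffusive \<Omega> \<gamma>2 C" "0 \<le> C"
    and par: "0 < d1" "0 < d2" "0 < f"
    and sol: "is_solution \<Omega> d1 d2 f \<kappa> \<gamma>1 \<gamma>2 u0 v0 u v"
begin

lemma solution_C1:
  "C1_X \<Omega> u (\<lambda>t. Fu \<Omega> d1 f \<gamma>1 (u t) (v t))" "C1_X \<Omega> v (\<lambda>t. Fv \<Omega> d2 f \<kappa> \<gamma>2 (u t) (v t))"
  using sol by (auto simp: is_solution_def)

lemma solution_Xsp:
  assumes "0 \<le> t"
  shows "u t \<in> Xsp \<Omega>" "v t \<in> Xsp \<Omega>"
  using solution_C1 assms by (auto simp: C1_X_def)

lemma solution_initial:
  "Linf \<Omega> (u 0) = Linf \<Omega> u0" "Linf \<Omega> (\<lambda>x. u 0 x - c) = Linf \<Omega> (\<lambda>x. u0 x - c)"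
  "Linf \<Omega> (v 0) = Linf \<Omega> v0"
  using sol by (auto simp: is_solution_def intro!: Linf_cong_AE elim!: eventually_mono)

lemma solution_u_le:
  assumes "1 \<le> U" "Linf \<Omega> u0 \<le> U" "0 \<le> t"
  shows "Linf \<Omega> (u t) \<le> U"
proof (rule Linf_substrate_le[OF solution_C1(1) diff(1,3) _ par(3)])
  fix t :: real assume "0 \<le> t"
  show "\<exists>a A. (AE x in lebesgue_on \<Omega>. Fu \<Omega> d1 f \<gamma>1 (u t) (v t) x = d1 * Gam \<Omega> \<gamma>1 (u t) x - a x * u t x + f) \<and>
      (AE x in lebesgue_on \<Omega>. f \<le> a x \<and> a x \<le> A)"
    using AE_square_le[OF solution_Xsp(2)[OF \<open>0 \<le> t\<close>] order_refl]
    by (intro exI[of _ "\<lambda>x. f + (v t x)\<^sup>2"] exI[of _ "f + (Linf \<Omega> (v t))\<^sup>2"])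
      (auto simp: Fu_def algebra_simps intro!: AE_I2)
qed (use par assms solution_initial in auto)

context
  fixes U V r :: real
  assumes U: "1 \<le> U" "Linf \<Omega> u0 \<le> U" and V: "Linf \<Omega> v0 < V" "U * V < f + \<kappa>"
    and r: "r = (f + \<kappa> - U * V) / 2"
begin

lemma solution_V_pos: "0 < V"
  using Linf_nonneg[OF solution_Xsp(2)[of 0]] V solution_initial by simp

lemma solution_rate_pos: "0 < r"
  using V by (simp add: r)

text \<open>At contact |u v| is at most \<open>U * m\<close> with \<open>m \<le> V\<close>, so the
  damping is at least \<open>f + \<kappa> - U * V = 2 * r\<close>, strictly more than the rate
  \<open>r\<close> of the barrier. Strictness also needs a positive barrier, which \<open>V\<close>
  provides even when \<open>v0\<close> vanishes.\<close>

lemma solution_v_le: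
  assumes t: "0 \<le> t"
  shows "Linf \<Omega> (v t) \<le> V * exp (- r * t)"
proof (rule C1_X_le_barrier[OF solution_C1(2) diff(2,3), where m' = "\<lambda>t. - r * (V * exp (- r * t))"])
  fix t :: real assume t: "0 \<le> t" and eq: "Linf \<Omega> (v t) = V * exp (- r * t)"
  define m where "m = V * exp (- r * t)"
  have m: "0 < m" "m \<le> V"
    using solution_V_pos solution_rate_pos t by (auto simp: m_def mult_le_cancel_left1)
  have uv: "AE x in lebesgue_on \<Omega>. \<bar>u t x * v t x\<bar> \<le> U * m"
    using AE_abs_le_Linf[OF solution_Xsp(1)[OF t]] AE_abs_le_Linf[OF solution_Xsp(2)[OF t]]
  proof eventually_elim
    case (elim x)
    have "\<bar>u t x\<bar> \<le> U"
      using elim solution_u_le[OF U t] by linarith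
    then show ?case
      unfolding abs_mult using elim eq U by (intro mult_mono) (auto simp: m_def)
  qed
  have "U * m \<le> U * V"
    using m U by simp
  then have "r < f + \<kappa> - U * m"
    using solution_rate_pos by (simp add: r field_simps)
  then have "r * m < (f + \<kappa> - U * m) * m"
    using m by simp
  then have "0 - (f + \<kappa> - U * m) * m < - r * m"
    by simp
  moreover have "AE x in lebesgue_on \<Omega>. f + \<kappa> - U * m \<le> f + \<kappa> - u t x * v t x
      \<and> f + \<kappa> - u t x * v t x \<le> f + \<kappa> + U * m"
    using uv by eventually_elim linarith
  ultimately show "\<exists>a g \<alpha> A \<beta>.
      (AE x in lebesgue_on \<Omega>. Fv \<Omega> d2 f \<kappa> \<gamma>2 (u t) (v t) x = d2 * Gam \<Omega> \<gamma>2 (v t) x - a x * v t x + g x) \<and>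
      (AE x in lebesgue_on \<Omega>. \<alpha> \<le> a x \<and> a x \<le> A) \<and>
      (AE x in lebesgue_on \<Omega>. \<bar>g x\<bar> \<le> \<beta>) \<and> 0 \<le> \<beta> \<and>
      \<beta> - \<alpha> * (V * exp (- r * t)) < - r * (V * exp (- r * t))"
    unfolding m_def[symmetric]
    by (intro exI[of _ "\<lambda>x. f + \<kappa> - u t x * v t x"] exI[of _ "\<lambda>x. 0"] exI[of _ "f + \<kappa> - U * m"]
        exI[of _ "f + \<kappa> + U * m"] exI[of _ 0])
      (auto simp: Fv_def algebra_simps power2_eq_square intro!: AE_I2)
qed (use par V t solution_initial in \<open>auto intro!: derivative_eq_intros\<close>)

text \<open>The deviation \<open>u - 1\<close> is damped at rate at least \<open>f\<close> and
  forced by \<open>v\<close> squared, which decays at rate \<open>2 * r\<close>. Since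
  \<open>s \<le> r\<close> the forcing decays at least as fast as the barrier; since
  \<open>s \<le> f / 2\<close> a damping of \<open>f / 2\<close> is left to beat it, and
  \<open>f / 2 * B\<close> exceeds the square of \<open>V\<close> by the choice of
  \<open>B\<close>.\<close>

lemma solution_u_minus_one_le:
  assumes B: "Linf \<Omega> (\<lambda>x. u0 x - 1) \<le> B" "2 * V\<^sup>2 / f < B" and s: "s = min (f / 2) r" and t: "0 \<le> t"
  shows "Linf \<Omega> (\<lambda>x. u t x - 1) \<le> B * exp (- s * t)"
proof (rule C1_X_le_barrier[OF C1_X_diff_const[OF solution_C1(1)] diff(1,3),
      where m' = "\<lambda>t. - s * (B * exp (- s * t))"])
  fix t :: real assume t: "0 \<le> t"
  define \<beta> where "\<beta> = (V * exp (- r * t))\<^sup>2"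
  have v2: "AE x in lebesgue_on \<Omega>. (v t x)\<^sup>2 \<le> \<beta>"
    unfolding \<beta>_def using solution_Xsp(2)[OF t] solution_v_le[OF t] by (rule AE_square_le)
  have srt: "s * t \<le> r * t" "0 \<le> r * t"
    using t s solution_rate_pos by (auto intro: mult_right_mono)
  have "\<beta> = V\<^sup>2 * exp (- (2 * (r * t)))"
    by (simp add: \<beta>_def power_mult_distrib flip: exp_double)
  also have "\<dots> \<le> V\<^sup>2 * exp (- s * t)"
    using srt by (intro mult_left_mono) auto
  also have "\<dots> < (f / 2 * B) * exp (- s * t)"
    using B(2) par by (simp add: field_simps)
  also have "\<dots> \<le> ((f - s) * B) * exp (- s * t)"
  proof (intro mult_right_mono)
    have "0 \<le> 2 * V\<^sup>2 / f"
      using par by simp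
    then show "0 \<le> B"
      using B(2) by linarith
  qed (use s in auto)
  finally have "\<beta> - f * (B * exp (- s * t)) < - s * (B * exp (- s * t))"
    by (simp add: algebra_simps)
  moreover have "Gam \<Omega> \<gamma>1 (\<lambda>x. u t x - 1) x = Gam \<Omega> \<gamma>1 (u t) x" for x
    by (simp add: Gam_def)
  moreover have "AE x in lebesgue_on \<Omega>. f + (v t x)\<^sup>2 \<le> f + \<beta>"
    using v2 by eventually_elim simp
  moreover have "0 \<le> \<beta>"
    by (simp add: \<beta>_def)
  ultimately show "\<exists>a g \<alpha> A \<beta>.
      (AE x in lebesgue_on \<Omega>. Fu \<Omega> d1 f \<gamma>1 (u t) (v t) x
        = d1 * Gam \<Omega> \<gamma>1 (\<lambda>x. u t x - 1) x - a x * (u t x - 1) + g x) \<and>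
      (AE x in lebesgue_on \<Omega>. \<alpha> \<le> a x \<and> a x \<le> A) \<and>
      (AE x in lebesgue_on \<Omega>. \<bar>g x\<bar> \<le> \<beta>) \<and> 0 \<le> \<beta> \<and>
      \<beta> - \<alpha> * (B * exp (- s * t)) < - s * (B * exp (- s * t))"
    using v2
    by (intro exI[of _ "\<lambda>x. f + (v t x)\<^sup>2"] exI[of _ "\<lambda>x. - (v t x)\<^sup>2"] exI[of _ f]
        exI[of _ "f + \<beta>"] exI[of _ \<beta>])
      (auto simp: Fu_def algebra_simps intro!: AE_I2)
qed (use par B t solution_initial in \<open>auto intro!: derivative_eq_intros\<close>)

lemma solution_tendsto:
  "((\<lambda>t. Linf \<Omega> (\<lambda>x. u t x - 1) + Linf \<Omega> (v t)) \<longlongrightarrow> 0) at_top"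
proof -
  \<comment> \<open>The summand 1 provides the strict inequality required of
    \<open>B\<close>.\<close>
  define B where "B = max (Linf \<Omega> (\<lambda>x. u0 x - 1)) (2 * V\<^sup>2 / f + 1)"
  define s where "s = min (f / 2) r"
  have s: "0 < s"
    using par solution_rate_pos by (simp add: s_def)
  have decay: "((\<lambda>t. exp (- c * t)) \<longlongrightarrow> 0) at_top" if "0 < c" for c :: real
    by (rule filterlim_compose[OF exp_at_bot], rule filterlim_tendsto_neg_mult_at_bot[OF tendsto_const])
      (use that in \<open>auto intro: filterlim_ident\<close>)
  have lim: "((\<lambda>t. B * exp (- s * t) + V * exp (- r * t)) \<longlongrightarrow> 0) at_top"
    using tendsto_add[OF tendsto_mult_left[OF decay[OF s], of B]
        tendsto_mult_left[OF decay[OF solution_rate_pos], of V]] by simp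
  show ?thesis
  proof (rule tendsto_sandwich[OF _ _ tendsto_const lim])
    show "\<forall>\<^sub>F t in at_top. 0 \<le> Linf \<Omega> (\<lambda>x. u t x - 1) + Linf \<Omega> (v t)"
      using eventually_ge_at_top[of 0]
      by eventually_elim (auto intro!: add_nonneg_nonneg Linf_nonneg Xsp_diff Xsp_const solution_Xsp)
    show "\<forall>\<^sub>F t in at_top. Linf \<Omega> (\<lambda>x. u t x - 1) + Linf \<Omega> (v t) \<le> B * exp (- s * t) + V * exp (- r * t)"
      using eventually_ge_at_top[of 0]
      by eventually_elim
        (intro add_mono solution_v_le solution_u_minus_one_le s_def; simp add: B_def)
  qed
qed

end

text \<open>The exponential bound is available only for levels \<open>V\<close> strictly above the
  norm of \<open>v0\<close>; let \<open>V\<close> decrease to that norm.\<close>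

lemma solution_v_le_initial:
  assumes U: "1 \<le> U" "Linf \<Omega> u0 \<le> U" and v0: "Linf \<Omega> v0 < (f + \<kappa>) / U" and t: "0 \<le> t"
  shows "Linf \<Omega> (v t) \<le> Linf \<Omega> v0"
proof (rule dense_ge_bounded[OF v0])
  fix V assume V: "Linf \<Omega> v0 < V" "V < (f + \<kappa>) / U"
  then have UV: "U * V < f + \<kappa>"
    using U by (simp add: field_simps)
  have "Linf \<Omega> (v t) \<le> V * exp (- ((f + \<kappa> - U * V) / 2) * t)"
    using solution_v_le[OF U V(1) UV refl t] .
  also have "\<dots> \<le> V"
    using solution_V_pos[OF U V(1) UV refl] solution_rate_pos[OF U V(1) UV refl] t
    by (simp add: mult_le_cancel_left1)
  finally show "Linf \<Omega> (v t) \<le> V" .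
qed

end

section \<open>Bounded Borel functions and Picard's theorem\<close>

text \<open>Functions rather than classes modulo null sets: this makes the space a Banach space under
  the plain supremum norm, and every element of \<^const>\<open>Xsp\<close> has a representative in it.\<close>

typedef (overloaded) 'a bmeasfun =
  "{f :: 'a::topological_space \<Rightarrow> real. f \<in> borel_measurable borel \<and> bounded (range f)}"
  morphisms apply_bmeasfun Bmeasfun
  by (rule exI[of _ "\<lambda>x. 0"]) (auto simp: bounded_def)

setup_lifting type_definition_bmeasfun

lemma bmeasfun_eqI: "(\<And>x. apply_bmeasfun f x = apply_bmeasfun g x) \<Longrightarrow> f = g"
  by transfer auto

lemma measurable_apply_bmeasfun [measurable]: "apply_bmeasfun f \<in> borel_measurable borel"
  by transfer simp

lemma apply_Bmeasfun:
  assumes "f \<in> borel_measurable borel" "\<And>x. \<bar>f x\<bar> \<le> C"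
  shows "apply_bmeasfun (Bmeasfun f) = f"
  using assms by (intro Bmeasfun_inverse) (auto intro!: boundedI)

instantiation bmeasfun :: (topological_space) real_vector
begin

lift_definition zero_bmeasfun :: "'a bmeasfun" is "\<lambda>_. 0"
  by (auto simp: bounded_def)

lift_definition plus_bmeasfun :: "'a bmeasfun \<Rightarrow> 'a bmeasfun \<Rightarrow> 'a bmeasfun" is "\<lambda>f g x. f x + g x"
  by (auto intro: bounded_plus_comp)

lift_definition minus_bmeasfun :: "'a bmeasfun \<Rightarrow> 'a bmeasfun \<Rightarrow> 'a bmeasfun" is "\<lambda>f g x. f x - g x"
  by (auto intro: bounded_minus_comp)

lift_definition uminus_bmeasfun :: "'a bmeasfun \<Rightarrow> 'a bmeasfun" is "\<lambda>f x. - f x"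
  by auto

lift_definition scaleR_bmeasfun :: "real \<Rightarrow> 'a bmeasfun \<Rightarrow> 'a bmeasfun" is "\<lambda>c f x. c * f x"
  using bounded_scaleR_comp by fastforce

instance
  by standard (transfer; simp add: algebra_simps fun_eq_iff)+

end

lemmas bmeasfun_rep_eqs [simp] =
  zero_bmeasfun.rep_eq plus_bmeasfun.rep_eq minus_bmeasfun.rep_eq uminus_bmeasfun.rep_eq
  scaleR_bmeasfun.rep_eq

instantiation bmeasfun :: (topological_space) real_normed_vector
begin

lift_definition norm_bmeasfun :: "'a bmeasfun \<Rightarrow> real" is "\<lambda>f. SUP x. \<bar>f x\<bar>" .

definition dist_bmeasfun :: "'a bmeasfun \<Rightarrow> 'a bmeasfun \<Rightarrow> real"
  where "dist_bmeasfun f g = norm (f - g)"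

definition sgn_bmeasfun :: "'a bmeasfun \<Rightarrow> 'a bmeasfun"
  where "sgn_bmeasfun f = f /\<^sub>R norm f"

definition uniformity_bmeasfun :: "('a bmeasfun \<times> 'a bmeasfun) filter"
  where "uniformity_bmeasfun = (INF e\<in>{0 <..}. principal {(x, y). dist x y < e})"

definition open_bmeasfun :: "'a bmeasfun set \<Rightarrow> bool"
  where "open_bmeasfun S = (\<forall>x\<in>S. \<forall>\<^sub>F (x', y) in uniformity. x' = x \<longrightarrow> y \<in> S)"

lemma abs_apply_le_norm: "\<bar>apply_bmeasfun f x\<bar> \<le> norm f"
proof transfer
  fix f :: "'a \<Rightarrow> real" and x
  assume "f \<in> borel_measurable borel \<and> bounded (range f)"
  then have "bounded (range (\<lambda>x. norm (f x)))"
    using bounded_norm_comp by blast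
  then show "\<bar>f x\<bar> \<le> (SUP x. \<bar>f x\<bar>)"
    by (auto intro!: cSUP_upper bounded_imp_bdd_above)
qed

lemma norm_bmeasfun_le: "(\<And>x. \<bar>apply_bmeasfun f x\<bar> \<le> b) \<Longrightarrow> norm f \<le> b"
  by transfer (auto intro!: cSUP_least)

instance
proof
  fix a :: real and f g :: "'a bmeasfun"
  show "norm f = 0 \<longleftrightarrow> f = 0"
  proof
    assume "norm f = 0"
    then have "\<bar>apply_bmeasfun f x\<bar> \<le> 0" for x
      using abs_apply_le_norm[of f x] by simp
    then show "f = 0"
      by (intro bmeasfun_eqI) simp
  next
    assume "f = 0"
    then show "norm f = 0"
      by (simp add: norm_bmeasfun.rep_eq)
  qed
  show "norm (f + g) \<le> norm f + norm g"
  proof (rule norm_bmeasfun_le)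
    fix x show "\<bar>apply_bmeasfun (f + g) x\<bar> \<le> norm f + norm g"
      using abs_apply_le_norm[of f x] abs_apply_le_norm[of g x] by simp
  qed
  have le: "norm (c *\<^sub>R h) \<le> \<bar>c\<bar> * norm h" for c and h :: "'a bmeasfun"
    by (rule norm_bmeasfun_le) (simp add: abs_mult mult_left_mono abs_apply_le_norm)
  show "norm (a *\<^sub>R f) = \<bar>a\<bar> * norm f"
  proof (cases "a = 0")
    case True
    then show ?thesis
      by (simp add: norm_bmeasfun.rep_eq)
  next
    case False
    then have "\<bar>a\<bar> * norm f \<le> norm (a *\<^sub>R f)"
      using le[of "inverse a" "a *\<^sub>R f"] by (simp add: field_simps)
    then show ?thesis
      using le[of a f] by simp
  qed
qed (auto simp: dist_bmeasfun_def sgn_bmeasfun_def uniformity_bmeasfun_def open_bmeasfun_def)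

end

instance bmeasfun :: (topological_space) banach
proof
  fix X :: "nat \<Rightarrow> 'a bmeasfun"
  assume X: "Cauchy X"
  have close: "\<bar>apply_bmeasfun (X m) x - apply_bmeasfun (X n) x\<bar> \<le> norm (X m - X n)" for m n x
    using abs_apply_le_norm[of "X m - X n" x] by simp
  have "Cauchy (\<lambda>n. apply_bmeasfun (X n) x)" for x
  proof (rule CauchyI)
    fix e :: real assume "0 < e"
    then obtain M where "\<And>m n. M \<le> m \<Longrightarrow> M \<le> n \<Longrightarrow> norm (X m - X n) < e"
      using CauchyD[OF X] by blast
    then have "\<forall>m\<ge>M. \<forall>n\<ge>M. norm (apply_bmeasfun (X m) x - apply_bmeasfun (X n) x) < e"
      unfolding real_norm_def using close order_le_less_trans by blast
    then show "\<exists>M. \<forall>m\<ge>M. \<forall>n\<ge>M. norm (apply_bmeasfun (X m) x - apply_bmeasfun (X n) x) < e"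
      by blast
  qed
  then have "\<exists>l. (\<lambda>n. apply_bmeasfun (X n) x) \<longlonglongrightarrow> l" for x
    using Cauchy_convergent convergent_def by blast
  then obtain l where l: "\<And>x. (\<lambda>n. apply_bmeasfun (X n) x) \<longlonglongrightarrow> l x"
    by metis
  \<comment> \<open>Letting \<open>n\<close> tend to infinity at fixed \<open>m\<close> gives a
    bound that does not depend on \<open>x\<close>: pointwise convergence becomes uniform.\<close>
  have tail: "\<bar>apply_bmeasfun (X m) x - l x\<bar> \<le> e" if "\<And>n. M \<le> n \<Longrightarrow> norm (X m - X n) < e" for e m M x
  proof (rule tendsto_upperbound)
    show "(\<lambda>n. \<bar>apply_bmeasfun (X m) x - apply_bmeasfun (X n) x\<bar>) \<longlonglongrightarrow> \<bar>apply_bmeasfun (X m) x - l x\<bar>"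
      by (intro tendsto_intros l)
    show "\<forall>\<^sub>F n in sequentially. \<bar>apply_bmeasfun (X m) x - apply_bmeasfun (X n) x\<bar> \<le> e"
      unfolding eventually_sequentially using close that by (meson less_imp_le order_trans)
  qed simp
  obtain M where M: "\<And>m n. M \<le> m \<Longrightarrow> M \<le> n \<Longrightarrow> norm (X m - X n) < 1"
    using CauchyD[OF X zero_less_one] by blast
  have bound: "\<bar>l x\<bar> \<le> norm (X M) + 1" for x
    using tail[of M M 1 x] M[of M] abs_apply_le_norm[of "X M" x] by simp
  have meas: "l \<in> borel_measurable borel"
    by (rule borel_measurable_LIMSEQ_real[OF l]) simp
  note L = apply_Bmeasfun[OF meas bound]
  have "X \<longlonglongrightarrow> Bmeasfun l"
  proof (rule LIMSEQ_I)
    fix e :: real assume "0 < e"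
    then have "0 < e / 2"
      by simp
    then obtain M where M: "\<And>m n. M \<le> m \<Longrightarrow> M \<le> n \<Longrightarrow> norm (X m - X n) < e / 2"
      using CauchyD[OF X] by blast
    have "norm (X m - Bmeasfun l) < e" if "M \<le> m" for m
    proof -
      have "norm (X m - Bmeasfun l) \<le> e / 2"
        using tail[of M m "e / 2"] M that by (intro norm_bmeasfun_le) (simp add: L)
      then show ?thesis
        using \<open>0 < e\<close> by simp
    qed
    then show "\<exists>M. \<forall>m\<ge>M. norm (X m - Bmeasfun l) < e"
      by blast
  qed
  then show "convergent X"
    by (rule convergentI)
qed

text \<open>Integrating the weight gains a factor \<open>1 / K\<close>, the source of the
  contraction in the Picard argument.\<close>

lemma norm_integral_le_exp:
  fixes g :: "real \<Rightarrow> 'a::banach"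
  assumes K: "0 < K" and T: "0 \<le> T" and g: "continuous_on {0..T} g"
    and bound: "\<And>s. 0 \<le> s \<Longrightarrow> s \<le> T \<Longrightarrow> norm (g s) \<le> M * exp (K * s)" and M: "0 \<le> M"
  shows "norm (integral {0..T} g) \<le> M / K * exp (K * T)"
proof -
  have "((\<lambda>s. M * exp (K * s)) has_integral (M / K * exp (K * T) - M / K * exp (K * 0))) {0..T}"
    using K T
    by (intro fundamental_theorem_of_calculus)
      (auto simp: has_real_derivative_iff_has_vector_derivative[symmetric] intro!: derivative_eq_intros)
  then have int: "(\<lambda>s. M * exp (K * s)) integrable_on {0..T}"
    and eq: "integral {0..T} (\<lambda>s. M * exp (K * s)) = M / K * exp (K * T) - M / K"
    by (auto simp: has_integral_iff)
  have "norm (integral {0..T} g) \<le> integral {0..T} (\<lambda>s. M * exp (K * s))"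
    using integrable_continuous_real[OF g] int bound by (rule integral_norm_bound_integral) auto
  also have "\<dots> \<le> M / K * exp (K * T)"
    using eq K M by simp
  finally show ?thesis .
qed

text \<open>The contraction is taken in the weighted norm \<open>sup\<^sub>t exp (- K t) * norm (w t)\<close> with
  \<open>K > L\<close>, so that a single fixed point argument covers the whole half-line.\<close>

lemma lipschitz_ode_global_solution:
  fixes F :: "'a::banach \<Rightarrow> 'a"
  assumes F: "L-lipschitz_on UNIV F"
  obtains w where "w 0 = w0" "\<And>t. 0 \<le> t \<Longrightarrow> (w has_vector_derivative F (w t)) (at t within {0..})"
proof -
  \<comment> \<open>Gives contraction constant \<open>1 / 2\<close>, and stays positive when
    \<open>L = 0\<close>.\<close>
  define K where "K = 2 * (L + 1)"
  have L: "0 \<le> L"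
    using F by (rule lipschitz_on_nonneg)
  then have K: "0 < K" and LK: "L / K \<le> 1 / 2"
    by (auto simp: K_def field_simps)
  have Fcont: "continuous_on S (\<lambda>s. F (h s))" if "continuous_on S h" for S and h :: "real \<Rightarrow> 'a"
    using continuous_on_compose2[OF lipschitz_on_continuous_on[OF F] that] by simp
  \<comment> \<open>The unknown is the rescaled \<open>y t = exp (- K * t) *\<^sub>R w t\<close>,
    whose plain sup norm is the weighted norm of \<open>w\<close>. Bounded continuous functions live
    on the whole line, so \<open>P\<close> below is continued to negative times by its value at 0
    through \<open>max 0 t\<close>.\<close>
  define G where "G y s = F (exp (K * s) *\<^sub>R apply_bcontfun y s)" for y :: "real \<Rightarrow>\<^sub>C 'a" and s
  define I where "I y t = integral {0..t} (G y)" for y t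
  define P where "P y t = exp (- K * max 0 t) *\<^sub>R (w0 + I y (max 0 t))" for y t
  have G: "continuous_on S (G y)" for y S
    unfolding G_def by (intro Fcont continuous_intros) auto
  have deriv: "(I y has_vector_derivative G y t) (at t within {0..})" if "0 \<le> t" for y t
  proof -
    have "(I y has_vector_derivative G y t) (at t within {0..t + 1})"
      unfolding I_def using that by (intro integral_has_vector_derivative G) auto
    moreover have "at t within {0..t + 1} = at t within {0..}"
      by (rule at_within_nhd[of _ "{..<t + 1}"]) auto
    ultimately show ?thesis
      by simp
  qed
  have Icont: "continuous_on {0..} (I y)" for y
    using deriv by (auto simp: continuous_on_eq_continuous_within intro: has_vector_derivative_continuous)
  have Pcont: "continuous_on UNIV (P y)" for y
    unfolding P_def
    by (intro continuous_intros continuous_on_compose2[OF Icont]) auto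
  have Pbound: "norm (P y t) \<le> norm w0 + (norm (F 0) + L * norm y) / K" for y t
  proof -
    have "norm (I y (max 0 t)) \<le> (norm (F 0) + L * norm y) / K * exp (K * max 0 t)"
      unfolding I_def
    proof (rule norm_integral_le_exp[OF K _ G])
      fix s :: real assume s: "0 \<le> s"
      have "norm (G y s - F 0) \<le> L * norm (exp (K * s) *\<^sub>R apply_bcontfun y s)"
        unfolding G_def using lipschitz_onD[OF F UNIV_I UNIV_I, of _ 0] by (metis dist_norm diff_zero)
      also have "\<dots> \<le> L * (exp (K * s) * norm y)"
        using L norm_bounded[of y s] by (simp add: mult_left_mono)
      finally have "norm (G y s) \<le> norm (F 0) + L * (exp (K * s) * norm y)"
        using norm_triangle_ineq2[of "G y s" "F 0"] by linarith
      moreover have "norm (F 0) * 1 \<le> norm (F 0) * exp (K * s)"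
        using K s by (intro mult_left_mono) auto
      ultimately show "norm (G y s) \<le> (norm (F 0) + L * norm y) * exp (K * s)"
        by (simp add: algebra_simps)
    qed (use L in auto)
    then have "norm (w0 + I y (max 0 t)) \<le> norm w0 + (norm (F 0) + L * norm y) / K * exp (K * max 0 t)"
      by (meson add_left_mono norm_triangle_ineq order_trans)
    moreover have "norm w0 * 1 \<le> norm w0 * exp (K * max 0 t)"
      using K by (intro mult_left_mono) auto
    ultimately have *: "norm (w0 + I y (max 0 t)) \<le> (norm w0 + (norm (F 0) + L * norm y) / K) * exp (K * max 0 t)"
      by (simp add: algebra_simps)
    have "norm (P y t) = exp (- K * max 0 t) * norm (w0 + I y (max 0 t))"
      by (simp add: P_def)
    also have "\<dots> \<le> exp (- K * max 0 t) * ((norm w0 + (norm (F 0) + L * norm y) / K) * exp (K * max 0 t))"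
      using * by (intro mult_left_mono) auto
    also have "\<dots> = norm w0 + (norm (F 0) + L * norm y) / K"
      by (simp add: exp_minus)
    finally show ?thesis .
  qed
  define \<Phi> where "\<Phi> y = Bcontfun (P y)" for y
  have \<Phi>: "apply_bcontfun (\<Phi> y) = P y" for y
    unfolding \<Phi>_def using bcontfun_normI[OF Pcont Pbound] by (rule Bcontfun_inverse)
  have "\<exists>!y. \<Phi> y = y"
  proof (rule banach_fix_type[of "1 / 2"])
    show "\<forall>y z. dist (\<Phi> y) (\<Phi> z) \<le> 1 / 2 * dist y z"
    proof (intro allI dist_bound)
      fix y z :: "real \<Rightarrow>\<^sub>C 'a" and t :: real
      have "norm (integral {0..max 0 t} (\<lambda>s. G y s - G z s)) \<le> L * dist y z / K * exp (K * max 0 t)"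
      proof (rule norm_integral_le_exp[OF K])
        show "continuous_on {0..max 0 t} (\<lambda>s. G y s - G z s)"
          by (intro continuous_intros G)
        fix s :: real
        have "norm (G y s - G z s) \<le> L * dist (exp (K * s) *\<^sub>R apply_bcontfun y s) (exp (K * s) *\<^sub>R apply_bcontfun z s)"
          unfolding G_def using lipschitz_onD[OF F] by (simp add: dist_norm)
        also have "\<dots> = L * (exp (K * s) * dist (apply_bcontfun y s) (apply_bcontfun z s))"
          by (simp add: dist_norm flip: scaleR_diff_right)
        also have "\<dots> \<le> L * (exp (K * s) * dist y z)"
          using L dist_bounded[of y s z] by (simp add: mult_left_mono)
        finally show "norm (G y s - G z s) \<le> L * dist y z * exp (K * s)"
          by (simp add: algebra_simps)
      qed (use L in auto)
      also have "integral {0..max 0 t} (\<lambda>s. G y s - G z s) = I y (max 0 t) - I z (max 0 t)"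
        unfolding I_def by (intro integral_diff integrable_continuous_real G)
      finally have *: "norm (I y (max 0 t) - I z (max 0 t)) \<le> L * dist y z / K * exp (K * max 0 t)" .
      have "dist (P y t) (P z t) = exp (- K * max 0 t) * norm (I y (max 0 t) - I z (max 0 t))"
        unfolding P_def dist_norm scaleR_diff_right[symmetric] by simp
      also have "\<dots> \<le> exp (- K * max 0 t) * (L * dist y z / K * exp (K * max 0 t))"
        using * by (intro mult_left_mono) auto
      also have "\<dots> = L / K * dist y z"
        by (simp add: exp_minus)
      also have "\<dots> \<le> 1 / 2 * dist y z"
        using LK by (intro mult_right_mono) auto
      finally show "dist (apply_bcontfun (\<Phi> y) t) (apply_bcontfun (\<Phi> z) t) \<le> 1 / 2 * dist y z"
        unfolding \<Phi> .
    qed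
  qed auto
  then obtain y where "\<Phi> y = y"
    by blast
  then have y: "apply_bcontfun y t = P y t" for t
    using \<Phi>[of y] by simp
  have w: "exp (K * t) *\<^sub>R apply_bcontfun y t = w0 + I y t" if "0 \<le> t" for t
    using that by (simp add: y P_def exp_minus)
  show thesis
  proof
    show "w0 + I y 0 = w0"
      by (simp add: I_def)
    fix t :: real assume "0 \<le> t"
    then show "((\<lambda>t. w0 + I y t) has_vector_derivative F (w0 + I y t)) (at t within {0..})"
      using deriv[of t y] w[of t] by (auto simp: G_def intro!: derivative_eq_intros)
  qed
qed

section \<open>Existence for small data\<close>

text \<open>Rests on completeness of Lebesgue measure. It gives membership of right-hand sides
  containing \<open>Gam\<close>, which are compared with Borel functions only almost
  everywhere.\<close>

lemma Xsp_cong_AE: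
  assumes "\<Omega> \<in> sets lebesgue" "z \<in> Xsp \<Omega>" and eq: "AE x in lebesgue_on \<Omega>. z x = y x"
  shows "y \<in> Xsp \<Omega>"
proof -
  have "(\<lambda>x. if x \<in> \<Omega> then z x else 0) \<in> borel_measurable lebesgue"
    using assms by (intro borel_measurable_if_I) (auto simp: Xsp_def)
  moreover have "AE x in lebesgue. (if x \<in> \<Omega> then z x else 0) = (if x \<in> \<Omega> then y x else 0)"
    using eq assms(1) by (auto simp: AE_restrict_space_iff elim!: eventually_mono)
  ultimately have "(\<lambda>x. if x \<in> \<Omega> then y x else 0) \<in> borel_measurable lebesgue"
    by (rule borel_measurable_AE)
  then have "y \<in> borel_measurable (lebesgue_on \<Omega>)"
    by (rule borel_measurable_if_D)
  moreover have "AE x in lebesgue_on \<Omega>. \<bar>y x\<bar> \<le> Linf \<Omega> z"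
    using eq AE_abs_le_Linf[OF assms(2)] by eventually_elim auto
  ultimately show ?thesis
    by (auto simp: Xsp_def)
qed

lemma bmeasfun_Xsp:
  fixes z :: "(real ^ 'n) bmeasfun"
  shows "apply_bmeasfun z \<in> Xsp \<Omega>"
proof -
  have "apply_bmeasfun z \<in> borel_measurable (lebesgue_on \<Omega>)"
    by (intro measurable_restrict_space1 measurable_completion) simp
  then show ?thesis
    using abs_apply_le_norm[of z] by (auto simp: Xsp_def intro!: AE_I2)
qed

lemma Linf_bmeasfun_le:
  fixes z :: "(real ^ 'n) bmeasfun"
  shows "Linf \<Omega> (apply_bmeasfun z) \<le> norm z"
  by (rule Linf_le) (auto simp: abs_apply_le_norm intro!: AE_I2)

lemma Xsp_bmeasfun_representative:
  fixes \<Omega> :: "(real ^ 'n) set"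
  assumes \<Omega>: "\<Omega> \<in> sets lebesgue" and z: "z \<in> Xsp \<Omega>"
  obtains y :: "(real ^ 'n) bmeasfun" where "AE x in lebesgue_on \<Omega>. apply_bmeasfun y x = z x"
proof -
  define N where "N = Linf \<Omega> z"
  have "(\<lambda>x. if x \<in> \<Omega> then z x else 0) \<in> borel_measurable lebesgue"
    using \<Omega> z by (intro borel_measurable_if_I) (auto simp: Xsp_def)
  then obtain y where y: "y \<in> borel_measurable lborel"
    and eq: "AE x in lborel. (if x \<in> \<Omega> then z x else 0) = y x"
    using completion_ex_borel_measurable_real by blast
  \<comment> \<open>A Borel version may be unbounded on a null set; cutting it at the essential
    bound repairs this without changing the class.\<close>
  define w where "w x = max (- N) (min N (y x))" for x
  have "w \<in> borel_measurable borel"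
    unfolding w_def using y by simp
  then have w: "apply_bmeasfun (Bmeasfun w) = w"
    using Linf_nonneg[OF z] by (intro apply_Bmeasfun[of _ N]) (auto simp: w_def N_def)
  have "AE x in lebesgue_on \<Omega>. z x = y x"
    using eq by (intro AE_lborel_imp_lebesgue_on[OF \<Omega>]) (auto elim!: eventually_mono)
  then have "AE x in lebesgue_on \<Omega>. apply_bmeasfun (Bmeasfun w) x = z x"
    unfolding w using AE_abs_le_Linf[OF z] by eventually_elim (auto simp: w_def N_def)
  then show thesis ..
qed

text \<open>The sup norm dominates \<open>Linf\<close>, so differentiability transfers. Only a.e.
  equality of \<open>W\<close> and \<open>D\<close> is asked for, because the nonlocal term of the
  original kernel and that of its Borel version agree no better.\<close>

lemma C1_X_bmeasfunI:
  fixes U D :: "real \<Rightarrow> (real ^ 'n) bmeasfun"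
  assumes \<Omega>: "\<Omega> \<in> sets lebesgue"
    and U: "\<And>t. 0 \<le> t \<Longrightarrow> (U has_vector_derivative D t) (at t within {0..})"
    and D: "continuous_on {0..} D"
    and W: "\<And>t. 0 \<le> t \<Longrightarrow> AE x in lebesgue_on \<Omega>. W t x = apply_bmeasfun (D t) x"
  shows "C1_X \<Omega> (\<lambda>t. apply_bmeasfun (U t)) W"
  unfolding C1_X_def
proof (intro conjI allI impI)
  fix t :: real assume t: "0 \<le> t"
  have "AE x in lebesgue_on \<Omega>. apply_bmeasfun (D t) x = W t x"
    using W[OF t] by eventually_elim simp
  then show "W t \<in> Xsp \<Omega>"
    by (rule Xsp_cong_AE[OF \<Omega> bmeasfun_Xsp])
  show "apply_bmeasfun (U t) \<in> Xsp \<Omega>"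
    by (rule bmeasfun_Xsp)
  show "((\<lambda>h. Linf \<Omega> (\<lambda>x. (apply_bmeasfun (U (t + h)) x - apply_bmeasfun (U t) x) / h - W t x)) \<longlongrightarrow> 0)
      (at 0 within {- t..})"
  proof (rule tendstoI)
    fix e :: real assume "0 < e"
    then obtain d where d: "0 < d" and
      q: "\<And>s. 0 \<le> s \<Longrightarrow> 0 < \<bar>s - t\<bar> \<Longrightarrow> \<bar>s - t\<bar> < d \<Longrightarrow>
        norm (U s - U t - (s - t) *\<^sub>R D t) / \<bar>s - t\<bar> < e"
      using U[OF t] unfolding has_vector_derivative_def has_derivative_within' by force
    have "\<bar>Linf \<Omega> (\<lambda>x. (apply_bmeasfun (U (t + h)) x - apply_bmeasfun (U t) x) / h - W t x)\<bar> < e"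
      if h: "- t \<le> h" "h \<noteq> 0" "\<bar>h\<bar> < d" for h
    proof -
      define y where "y = (1 / h) *\<^sub>R (U (t + h) - U t - h *\<^sub>R D t)"
      have "AE x in lebesgue_on \<Omega>. (apply_bmeasfun (U (t + h)) x - apply_bmeasfun (U t) x) / h - W t x
          = apply_bmeasfun y x"
        using W[OF t] by eventually_elim (use h in \<open>simp add: y_def field_simps\<close>)
      then have "Linf \<Omega> (\<lambda>x. (apply_bmeasfun (U (t + h)) x - apply_bmeasfun (U t) x) / h - W t x)
          = Linf \<Omega> (apply_bmeasfun y)"
        by (rule Linf_cong_AE)
      moreover have "norm y < e"
        using q[of "t + h"] h by (simp add: y_def)
      ultimately show ?thesis
        using Linf_bmeasfun_le[of \<Omega> y] Linf_nonneg[OF bmeasfun_Xsp[of y \<Omega>]] by simp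
    qed
    then show "\<forall>\<^sub>F h in at 0 within {- t..}.
        dist (Linf \<Omega> (\<lambda>x. (apply_bmeasfun (U (t + h)) x - apply_bmeasfun (U t) x) / h - W t x)) 0 < e"
      unfolding eventually_at using d by (auto simp: dist_real_def)
  qed
  have lim: "((\<lambda>s. norm (D s - D t)) \<longlongrightarrow> 0) (at t within {0..})"
    using D t by (auto simp: continuous_on_def LIM_zero tendsto_norm_zero)
  show "((\<lambda>s. Linf \<Omega> (\<lambda>x. W s x - W t x)) \<longlongrightarrow> 0) (at t within {0..})"
  proof (rule Lim_null_comparison[OF _ lim])
    have "norm (Linf \<Omega> (\<lambda>x. W s x - W t x)) \<le> norm (D s - D t)" if "0 \<le> s" for s
    proof -
      have "AE x in lebesgue_on \<Omega>. W s x - W t x = apply_bmeasfun (D s - D t) x"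
        using W[OF t] W[OF that] by eventually_elim simp
      then have "Linf \<Omega> (\<lambda>x. W s x - W t x) = Linf \<Omega> (apply_bmeasfun (D s - D t))"
        by (rule Linf_cong_AE)
      then show ?thesis
        using Linf_bmeasfun_le[of \<Omega> "D s - D t"] Linf_nonneg[OF bmeasfun_Xsp[of "D s - D t" \<Omega>]] by simp
    qed
    then show "\<forall>\<^sub>F s in at t within {0..}. norm (Linf \<Omega> (\<lambda>x. W s x - W t x)) \<le> norm (D s - D t)"
      by (auto simp: eventually_at intro!: exI[of _ 1])
  qed
qed

section \<open>The nonlocal operator on bounded Borel functions\<close>

text \<open>The counterpart of \<open>Gam\<close> for a Borel kernel. It yields a bounded Borel
  function at every point, so the vector field can map \<open>bmeasfun\<close> into itself.\<close>

definition nonloc ::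
    "(real ^ 'n) set \<Rightarrow> ((real ^ 'n) \<times> (real ^ 'n) \<Rightarrow> real) \<Rightarrow> (real ^ 'n) bmeasfun \<Rightarrow> real ^ 'n \<Rightarrow> real" where
  "nonloc \<Omega> g z x = (LINT y|lborel. g (x, y) *
     ((if y \<in> \<Omega> then apply_bmeasfun z y else 0) - apply_bmeasfun z x))"

lemma nonloc_measurable:
  assumes "borel_kernel g C" and [measurable]: "\<Omega> \<in> sets borel"
  shows "nonloc \<Omega> g z \<in> borel_measurable borel"
proof -
  have [measurable]: "g \<in> borel_measurable (borel \<Otimes>\<^sub>M borel)"
    using assms by (simp add: borel_kernel_def borel_prod)
  show ?thesis
    unfolding nonloc_def by measurable
qed

text \<open>The bracket \<open>J z\<close> is linear in \<open>z\<close> and at most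
  \<open>2 * norm z\<close>: one norm for the value at \<open>t\<close>, one for the value at
  \<open>x\<close>.\<close>

lemma nonloc_lipschitz:
  assumes g: "borel_kernel g C" "0 \<le> C" and \<Omega>: "\<Omega> \<in> sets borel"
  shows "\<bar>nonloc \<Omega> g z x - nonloc \<Omega> g y x\<bar> \<le> 2 * C * norm (z - y)"
proof -
  define J where "J z t = (if t \<in> \<Omega> then apply_bmeasfun z t else 0) - apply_bmeasfun z x"
    for z :: "(real ^ 'a) bmeasfun" and t
  note [measurable] = borel_kernel_measurable[OF g(1), of x] \<Omega>
  have J: "\<bar>J z t\<bar> \<le> 2 * norm z" for z t
    using abs_apply_le_norm[of z t] abs_apply_le_norm[of z x] by (auto simp: J_def)
  have g0: "0 \<le> g p" for p
    using g(1) unfolding borel_kernel_def by blast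
  have dom: "integrable lborel (\<lambda>t. g (x, t) * c)" for c
    using borel_kernel_integrable[OF g(1)] by simp
  have bound: "\<bar>g (x, t) * J z t\<bar> \<le> g (x, t) * (2 * norm z)" for z t
    using J g0 by (simp add: abs_mult mult_left_mono)
  have int: "integrable lborel (\<lambda>t. g (x, t) * J z t)" for z
  proof (rule Bochner_Integration.integrable_bound[OF dom[of "2 * norm z"]])
    show "(\<lambda>t. g (x, t) * J z t) \<in> borel_measurable lborel"
      unfolding J_def by measurable
    show "AE t in lborel. norm (g (x, t) * J z t) \<le> norm (g (x, t) * (2 * norm z))"
      using bound[of _ z] by (intro AE_I2) (simp add: g0)
  qed
  have "nonloc \<Omega> g z x - nonloc \<Omega> g y x = (LINT t|lborel. g (x, t) * J z t - g (x, t) * J y t)"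
    using int by (simp add: nonloc_def J_def)
  also have "\<dots> = (LINT t|lborel. g (x, t) * J (z - y) t)"
    by (intro Bochner_Integration.integral_cong) (auto simp: J_def algebra_simps)
  finally have "\<bar>nonloc \<Omega> g z x - nonloc \<Omega> g y x\<bar> = norm (LINT t|lborel. g (x, t) * J (z - y) t)"
    by simp
  also have "\<dots> \<le> (LINT t|lborel. g (x, t) * (2 * norm (z - y)))"
    using bound[of _ "z - y"]
    by (intro order_trans[OF integral_norm_bound] integral_mono integrable_norm int dom) simp
  also have "\<dots> = (LINT t|lborel. g (x, t)) * (2 * norm (z - y))"
    by simp
  also have "\<dots> \<le> C * (2 * norm (z - y))"
    using borel_kernel_integral_le[OF g] by (intro mult_right_mono) auto
  finally show ?thesis
    by simp
qed

lemma Gam_eq_nonloc: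
  assumes \<Omega>: "\<Omega> \<in> sets borel" and g: "borel_kernel g C" "kernel_version \<Omega> \<gamma> g"
  shows "AE x in lebesgue_on \<Omega>. Gam \<Omega> \<gamma> (apply_bmeasfun z) x = nonloc \<Omega> g z x"
proof -
  have leb: "\<Omega> \<in> sets lebesgue"
    using \<Omega> by (simp add: sets_completionI_sets)
  show ?thesis
    using Gam_kernel_version[OF leb g]
  proof eventually_elim
    case (elim x)
    note [measurable] = borel_kernel_measurable[OF g(1), of x] \<Omega>
    have "apply_bmeasfun z \<in> borel_measurable (lebesgue_on \<Omega>)"
      using bmeasfun_Xsp[of z \<Omega>] by (simp add: Xsp_def)
    then have "Gam \<Omega> \<gamma> (apply_bmeasfun z) x = (LINT y|lebesgue. g (x, y) *
        ((if y \<in> \<Omega> then apply_bmeasfun z y else 0) - apply_bmeasfun z x))"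
      using elim by blast
    also have "\<dots> = nonloc \<Omega> g z x"
      unfolding nonloc_def by (rule integral_completion) measurable
    finally show ?case .
  qed
qed

section \<open>Truncation of the reaction term\<close>

definition clip :: "real \<Rightarrow> real \<Rightarrow> real" where
  "clip b y = max (- b) (min b y)"

lemma clip_measurable [measurable]: "clip b \<in> borel_measurable borel"
  unfolding clip_def by measurable

lemma abs_clip_le: "0 \<le> b \<Longrightarrow> \<bar>clip b y\<bar> \<le> b"
  by (auto simp: clip_def)

lemma clip_lipschitz: "\<bar>clip b y - clip b z\<bar> \<le> \<bar>y - z\<bar>"
  by (auto simp: clip_def max_def min_def)

lemma clip_eq: "\<bar>y\<bar> \<le> b \<Longrightarrow> clip b y = y"
  by (auto simp: clip_def)

text \<open>Lets a truncated factor be rewritten as a coefficient in [0,1] times the untruncated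
  one, so that truncated equations still have the damped linear form of the norm estimates.\<close>

lemma clip_factor:
  assumes "0 \<le> b"
  obtains \<theta> where "\<And>y. clip b y = \<theta> y * y" "\<And>y. 0 \<le> \<theta> y" "\<And>y. \<theta> y \<le> 1"
proof
  define \<theta> where "\<theta> y = (if y = 0 then 0 else clip b y / y)" for y
  show "clip b y = \<theta> y * y" for y
    using assms by (auto simp: \<theta>_def clip_def)
  show "0 \<le> \<theta> y" "\<theta> y \<le> 1" for y
    using assms by (auto simp: \<theta>_def clip_def divide_simps max_def min_def)
qed

lemma clip_reaction_lipschitz:
  assumes b: "0 \<le> b"
  shows "\<bar>clip 2 u * (clip b v)\<^sup>2 - clip 2 u' * (clip b v')\<^sup>2\<bar> \<le> b\<^sup>2 * \<bar>u - u'\<bar> + 4 * b * \<bar>v - v'\<bar>"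
proof -
  have "clip 2 u * (clip b v)\<^sup>2 - clip 2 u' * (clip b v')\<^sup>2
      = (clip 2 u - clip 2 u') * (clip b v)\<^sup>2 + clip 2 u' * (clip b v + clip b v') * (clip b v - clip b v')"
    by (simp add: algebra_simps power2_eq_square)
  moreover have "\<bar>(clip 2 u - clip 2 u') * (clip b v)\<^sup>2\<bar> \<le> \<bar>u - u'\<bar> * b\<^sup>2"
    unfolding abs_mult using clip_lipschitz[of 2 u u'] power_mono[OF abs_clip_le[OF b, of v], of 2]
    by (intro mult_mono) auto
  moreover have "\<bar>clip b v + clip b v'\<bar> \<le> 2 * b"
    using abs_clip_le[OF b, of v] abs_clip_le[OF b, of v'] by linarith
  then have "\<bar>clip 2 u' * (clip b v + clip b v') * (clip b v - clip b v')\<bar> \<le> (2 * (2 * b)) * \<bar>v - v'\<bar>"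
    unfolding abs_mult using clip_lipschitz[of b v v'] abs_clip_le[of 2 u'] b
    by (intro mult_mono) auto
  ultimately show ?thesis
    by (simp add: algebra_simps)
qed

text \<open>The cutoffs are 2 for \<open>u\<close> and \<open>b = (f + \<kappa>) / 4\<close> for
  \<open>v\<close>, the bounds on the data. Truncated production is at most \<open>2 * b\<close>,
  half of the removal rate \<open>f + \<kappa> = 4 * b\<close>, so \<open>v\<close> cannot pass
  \<open>b\<close>; \<open>u\<close> cannot pass 2 because 2 is above 1. The solution of the
  truncated system therefore solves the original one.\<close>

lemma small_data_solution_exists:
  fixes \<Omega> :: "(real ^ 'n) set"
  assumes \<Omega>: "open \<Omega>"
    and g1: "borel_kernel g1 C" "kernel_version \<Omega> \<gamma>1 g1"
    and g2: "borel_kernel g2 C" "kernel_version \<Omega> \<gamma>2 g2" and C: "0 \<le> C"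
    and par: "0 < d1" "0 < d2" "0 < f" "0 < \<kappa>"
    and u0: "u0 \<in> Xsp \<Omega>" "Linf \<Omega> u0 \<le> 2"
    and v0: "v0 \<in> Xsp \<Omega>" "Linf \<Omega> v0 \<le> (f + \<kappa>) / 4"
  shows "\<exists>u v. is_solution \<Omega> d1 d2 f \<kappa> \<gamma>1 \<gamma>2 u0 v0 u v"
proof -
  have bor: "\<Omega> \<in> sets borel" and leb: "\<Omega> \<in> sets lebesgue"
    using \<Omega> by auto
  note diff1 = diffusive_kernel_version[OF leb g1 C] and diff2 = diffusive_kernel_version[OF leb g2 C]
  define b where "b = (f + \<kappa>) / 4"
  have b: "0 < b" "0 \<le> b"
    using par by (auto simp: b_def)
  define R where "R p x = clip 2 (apply_bmeasfun (fst p) x) * (clip b (apply_bmeasfun (snd p) x))\<^sup>2"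
    for p :: "(real ^ 'n) bmeasfun \<times> (real ^ 'n) bmeasfun" and x
  define p1 where "p1 p x = d1 * nonloc \<Omega> g1 (fst p) x - R p x + f * (1 - apply_bmeasfun (fst p) x)" for p x
  define p2 where "p2 p x = d2 * nonloc \<Omega> g2 (snd p) x + R p x - (f + \<kappa>) * apply_bmeasfun (snd p) x" for p x
  define L where "L = d1 * (2 * C) + d2 * (2 * C) + b\<^sup>2 + 4 * b + f + (f + \<kappa>)"
  define n where "n p = norm (fst p) + norm (snd p)" for p :: "(real ^ 'n) bmeasfun \<times> (real ^ 'n) bmeasfun"
  have dC: "0 \<le> d1 * (2 * C)" "0 \<le> d2 * (2 * C)"
    using par C by auto
  have L: "0 \<le> L"
    using dC b par by (simp add: L_def)
  have apply_diff: "\<bar>apply_bmeasfun z x - apply_bmeasfun y x\<bar> \<le> norm (z - y)" for z y :: "(real ^ 'n) bmeasfun" and x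
    using abs_apply_le_norm[of "z - y" x] by simp
  have R_lip: "\<bar>R p x - R q x\<bar> \<le> b\<^sup>2 * norm (fst p - fst q) + 4 * b * norm (snd p - snd q)" for p q x
    unfolding R_def
    by (rule order_trans[OF clip_reaction_lipschitz[OF b(2)]])
      (use b apply_diff in \<open>auto intro!: add_mono mult_left_mono\<close>)
  have p1_lip: "\<bar>p1 p x - p1 q x\<bar> \<le> L * n (p - q)" for p q x
  proof -
    have "d1 * \<bar>nonloc \<Omega> g1 (fst p) x - nonloc \<Omega> g1 (fst q) x\<bar> \<le> d1 * (2 * C * norm (fst p - fst q))"
      using par by (intro mult_left_mono nonloc_lipschitz[OF g1(1) C bor]) auto
    moreover have "f * \<bar>apply_bmeasfun (fst p) x - apply_bmeasfun (fst q) x\<bar> \<le> f * norm (fst p - fst q)"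
      using par by (intro mult_left_mono apply_diff) auto
    moreover have "\<bar>p1 p x - p1 q x\<bar> \<le> d1 * \<bar>nonloc \<Omega> g1 (fst p) x - nonloc \<Omega> g1 (fst q) x\<bar>
        + \<bar>R p x - R q x\<bar> + f * \<bar>apply_bmeasfun (fst p) x - apply_bmeasfun (fst q) x\<bar>"
    proof -
      have "p1 p x - p1 q x = d1 * (nonloc \<Omega> g1 (fst p) x - nonloc \<Omega> g1 (fst q) x)
          - (R p x - R q x) - f * (apply_bmeasfun (fst p) x - apply_bmeasfun (fst q) x)"
        by (simp add: p1_def algebra_simps)
      moreover have "\<bar>a - b - c\<bar> \<le> \<bar>a\<bar> + \<bar>b\<bar> + \<bar>c\<bar>" for a b c :: real
        by linarith
      ultimately show ?thesis
        using par by (metis abs_mult abs_of_pos)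
    qed
    ultimately have "\<bar>p1 p x - p1 q x\<bar>
        \<le> (d1 * (2 * C) + b\<^sup>2 + f) * norm (fst p - fst q) + 4 * b * norm (snd p - snd q)"
      using R_lip[of p x q] by (simp add: algebra_simps)
    also have "\<dots> \<le> L * norm (fst p - fst q) + L * norm (snd p - snd q)"
      using dC b par by (intro add_mono mult_right_mono) (auto simp: L_def)
    finally show ?thesis
      by (simp add: n_def algebra_simps)
  qed
  have p2_lip: "\<bar>p2 p x - p2 q x\<bar> \<le> L * n (p - q)" for p q x
  proof -
    have "d2 * \<bar>nonloc \<Omega> g2 (snd p) x - nonloc \<Omega> g2 (snd q) x\<bar> \<le> d2 * (2 * C * norm (snd p - snd q))"
      using par by (intro mult_left_mono nonloc_lipschitz[OF g2(1) C bor]) auto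
    moreover have "(f + \<kappa>) * \<bar>apply_bmeasfun (snd p) x - apply_bmeasfun (snd q) x\<bar> \<le> (f + \<kappa>) * norm (snd p - snd q)"
      using par by (intro mult_left_mono apply_diff) auto
    moreover have "\<bar>p2 p x - p2 q x\<bar> \<le> d2 * \<bar>nonloc \<Omega> g2 (snd p) x - nonloc \<Omega> g2 (snd q) x\<bar>
        + \<bar>R p x - R q x\<bar> + (f + \<kappa>) * \<bar>apply_bmeasfun (snd p) x - apply_bmeasfun (snd q) x\<bar>"
    proof -
      have "p2 p x - p2 q x = d2 * (nonloc \<Omega> g2 (snd p) x - nonloc \<Omega> g2 (snd q) x)
          + (R p x - R q x) - (f + \<kappa>) * (apply_bmeasfun (snd p) x - apply_bmeasfun (snd q) x)"
        by (simp add: p2_def algebra_simps)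
      moreover have "\<bar>a + b - c\<bar> \<le> \<bar>a\<bar> + \<bar>b\<bar> + \<bar>c\<bar>" for a b c :: real
        by linarith
      moreover have "0 < f + \<kappa>"
        using par by simp
      ultimately show ?thesis
        using par by (metis abs_mult abs_of_pos)
    qed
    ultimately have "\<bar>p2 p x - p2 q x\<bar>
        \<le> b\<^sup>2 * norm (fst p - fst q) + (d2 * (2 * C) + 4 * b + (f + \<kappa>)) * norm (snd p - snd q)"
      using R_lip[of p x q] by (simp add: algebra_simps)
    also have "\<dots> \<le> L * norm (fst p - fst q) + L * norm (snd p - snd q)"
      using dC b par by (intro add_mono mult_right_mono) (auto simp: L_def)
    finally show ?thesis
      by (simp add: n_def algebra_simps)
  qed
  \<comment> \<open>Values at zero turn the Lipschitz bounds into boundedness, without which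
    \<open>Bmeasfun\<close> would not represent these functions.\<close>
  have p1_0: "p1 0 x = f" and p2_0: "p2 0 x = 0" for x
    by (auto simp: p1_def p2_def R_def nonloc_def clip_def cong: if_cong)
  note [measurable] = nonloc_measurable[OF g1(1) bor] nonloc_measurable[OF g2(1) bor]
  have m1: "p1 p \<in> borel_measurable borel" for p
    unfolding p1_def R_def by measurable
  have m2: "p2 p \<in> borel_measurable borel" for p
    unfolding p2_def R_def by measurable
  have bd1: "\<bar>p1 p x\<bar> \<le> f + L * n p" for p x
    using p1_lip[of p x 0] par by (simp add: p1_0)
  have bd2: "\<bar>p2 p x\<bar> \<le> L * n p" for p x
    using p2_lip[of p x 0] by (simp add: p2_0)
  define F where "F p = (Bmeasfun (p1 p), Bmeasfun (p2 p))" for p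
  have F1: "apply_bmeasfun (fst (F p)) = p1 p" and F2: "apply_bmeasfun (snd (F p)) = p2 p" for p
    using apply_Bmeasfun[OF m1 bd1] apply_Bmeasfun[OF m2 bd2] by (auto simp: F_def)
  \<comment> \<open>A factor 2 comes from the two components, another from
    \<open>n p \<le> 2 * norm p\<close>.\<close>
  have F_lip: "(4 * L)-lipschitz_on UNIV F"
  proof (rule lipschitz_onI)
    fix p q
    have "norm (F p - F q) \<le> norm (fst (F p) - fst (F q)) + norm (snd (F p) - snd (F q))"
      using norm_Pair_le[of "fst (F p - F q)" "snd (F p - F q)"] unfolding prod.collapse by simp
    also have "\<dots> \<le> L * n (p - q) + L * n (p - q)"
      using p1_lip p2_lip by (intro add_mono norm_bmeasfun_le) (auto simp: F1 F2)
    also have "\<dots> \<le> 4 * L * norm (p - q)"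
    proof -
      have "n (p - q) \<le> 2 * norm (p - q)"
        using norm_fst_le[of "fst (p - q)" "snd (p - q)"] norm_snd_le[of "snd (p - q)" "fst (p - q)"]
        unfolding prod.collapse n_def by linarith
      then show ?thesis
        using mult_left_mono[OF _ L] by fastforce
    qed
    finally show "dist (F p) (F q) \<le> 4 * L * dist p q"
      by (simp add: dist_norm)
  qed (use L in simp)
  obtain ub :: "(real ^ 'n) bmeasfun" where ub: "AE x in lebesgue_on \<Omega>. apply_bmeasfun ub x = u0 x"
    using Xsp_bmeasfun_representative[OF leb u0(1)] .
  obtain vb :: "(real ^ 'n) bmeasfun" where vb: "AE x in lebesgue_on \<Omega>. apply_bmeasfun vb x = v0 x"
    using Xsp_bmeasfun_representative[OF leb v0(1)] .
  obtain w where w0: "w 0 = (ub, vb)"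
    and w: "\<And>t. 0 \<le> t \<Longrightarrow> (w has_vector_derivative F (w t)) (at t within {0..})"
    using lipschitz_ode_global_solution[OF F_lip, of "(ub, vb)"] by blast
  have wcont: "continuous_on {0..} w"
    using w by (auto simp: continuous_on_eq_continuous_within intro: has_vector_derivative_continuous)
  have Fcont: "continuous_on {0..} (\<lambda>t. F (w t))"
    using continuous_on_compose2[OF lipschitz_on_continuous_on[OF F_lip] wcont] by simp
  have dU: "((\<lambda>t. fst (w t)) has_vector_derivative fst (F (w t))) (at t within {0..})"
    and dV: "((\<lambda>t. snd (w t)) has_vector_derivative snd (F (w t))) (at t within {0..})" if "0 \<le> t" for t
    using bounded_linear.has_vector_derivative[OF bounded_linear_fst w[OF that]]
      bounded_linear.has_vector_derivative[OF bounded_linear_snd w[OF that]] by auto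
  define u where "u t = apply_bmeasfun (fst (w t))" for t
  define v where "v t = apply_bmeasfun (snd (w t))" for t
  define W1 where "W1 t x = d1 * Gam \<Omega> \<gamma>1 (u t) x - R (w t) x + f * (1 - u t x)" for t x
  define W2 where "W2 t x = d2 * Gam \<Omega> \<gamma>2 (v t) x + R (w t) x - (f + \<kappa>) * v t x" for t x
  have W1: "AE x in lebesgue_on \<Omega>. W1 t x = apply_bmeasfun (fst (F (w t))) x" for t
    using Gam_eq_nonloc[OF bor g1, of "fst (w t)"]
    by eventually_elim (simp add: F1 W1_def p1_def u_def)
  have W2: "AE x in lebesgue_on \<Omega>. W2 t x = apply_bmeasfun (snd (F (w t))) x" for t
    using Gam_eq_nonloc[OF bor g2, of "snd (w t)"]
    by eventually_elim (simp add: F2 W2_def p2_def v_def)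
  \<comment> \<open>Any a.e. version of the right-hand side is allowed: first the truncated one, for
    the bounds, and later the original one, once the truncation is known to be inactive.\<close>
  have C1: "C1_X \<Omega> u W" if "\<And>t. 0 \<le> t \<Longrightarrow> AE x in lebesgue_on \<Omega>. W t x = W1 t x" for W
    unfolding u_def
  proof (rule C1_X_bmeasfunI[OF leb dU])
    show "continuous_on {0..} (\<lambda>t. fst (F (w t)))"
      using Fcont by (rule continuous_on_fst)
    show "AE x in lebesgue_on \<Omega>. W t x = apply_bmeasfun (fst (F (w t))) x" if "0 \<le> t" for t
      using W1[of t] \<open>\<And>t. 0 \<le> t \<Longrightarrow> AE x in lebesgue_on \<Omega>. W t x = W1 t x\<close>[OF that]
      by eventually_elim simp
  qed
  have C2: "C1_X \<Omega> v W" if "\<And>t. 0 \<le> t \<Longrightarrow> AE x in lebesgue_on \<Omega>. W t x = W2 t x" for W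
    unfolding v_def
  proof (rule C1_X_bmeasfunI[OF leb dV])
    show "continuous_on {0..} (\<lambda>t. snd (F (w t)))"
      using Fcont by (rule continuous_on_snd)
    show "AE x in lebesgue_on \<Omega>. W t x = apply_bmeasfun (snd (F (w t))) x" if "0 \<le> t" for t
      using W2[of t] \<open>\<And>t. 0 \<le> t \<Longrightarrow> AE x in lebesgue_on \<Omega>. W t x = W2 t x\<close>[OF that]
      by eventually_elim simp
  qed
  have trunc1: "C1_X \<Omega> u W1" and trunc2: "C1_X \<Omega> v W2"
    by (auto intro: C1 C2)
  have init: "AE x in lebesgue_on \<Omega>. u 0 x = u0 x" "AE x in lebesgue_on \<Omega>. v 0 x = v0 x"
    using ub vb by (simp_all add: u_def v_def w0)
  obtain \<theta> where \<theta>: "\<And>y. clip 2 y = \<theta> y * y" "\<And>y. 0 \<le> \<theta> y" "\<And>y. \<theta> y \<le> 1"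
    using clip_factor[of 2] by auto
  obtain \<psi> where \<psi>: "\<And>y. clip b y = \<psi> y * y" "\<And>y. 0 \<le> \<psi> y" "\<And>y. \<psi> y \<le> 1"
    using clip_factor[OF b(2)] by auto
  have clip_sq: "(clip b y)\<^sup>2 \<le> b\<^sup>2" for y
    using power_mono[OF abs_clip_le[OF b(2), of y], of 2] by simp
  have u_le: "Linf \<Omega> (u t) \<le> 2" if "0 \<le> t" for t
  proof (rule Linf_substrate_le[OF trunc1 diff1 C _ par(3) _ _ _ that])
    fix t :: real
    \<comment> \<open>Extracting \<open>u\<close> from its cutoff turns the truncated reaction into
      extra nonnegative damping.\<close>
    have "0 \<le> \<theta> (u t x) * (clip b (v t x))\<^sup>2" for x
      using \<theta>(2) by simp
    moreover have "\<theta> (u t x) * (clip b (v t x))\<^sup>2 \<le> 1 * b\<^sup>2" for x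
      by (rule mult_mono[OF \<theta>(3) clip_sq]) auto
    ultimately show "\<exists>a A. (AE x in lebesgue_on \<Omega>. W1 t x = d1 * Gam \<Omega> \<gamma>1 (u t) x - a x * u t x + f) \<and>
        (AE x in lebesgue_on \<Omega>. f \<le> a x \<and> a x \<le> A)"
      by (intro exI[of _ "\<lambda>x. f + \<theta> (u t x) * (clip b (v t x))\<^sup>2"] exI[of _ "f + b\<^sup>2"])
        (auto simp: W1_def R_def u_def v_def \<theta>(1) algebra_simps intro!: AE_I2)
  next
    show "Linf \<Omega> (u 0) \<le> 2"
      using Linf_cong_AE[OF init(1)] u0 by simp
  qed (use par in auto)
  have v_le: "Linf \<Omega> (v t) \<le> b" if "0 \<le> t" for t
  proof (rule C1_X_le_barrier[OF trunc2 diff2 C, where m' = "\<lambda>t. 0"])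
    fix t :: real
    \<comment> \<open>Only one of the two factors \<open>clip b v\<close> is written as \<psi> times
      \<open>v\<close>; the other stays bounded by \<open>b\<close> and joins the
      coefficient.\<close>
    define a where "a x = f + \<kappa> - clip 2 (u t x) * (clip b (v t x) * \<psi> (v t x))" for x
    have prod_le: "\<bar>clip 2 (u t x) * (clip b (v t x) * \<psi> (v t x))\<bar> \<le> 2 * (b * 1)" for x
      unfolding abs_mult using abs_clip_le[of 2 "u t x"] abs_clip_le[OF b(2), of "v t x"] \<psi>(2,3) b
      by (intro mult_mono) auto
    have "f + \<kappa> = 4 * b"
      by (simp add: b_def)
    then have "2 * b \<le> a x \<and> a x \<le> 6 * b" for x
      unfolding a_def using prod_le[of x] by linarith
    moreover have "W2 t x = d2 * Gam \<Omega> \<gamma>2 (v t) x - a x * v t x + 0" for x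
    proof -
      have "(clip b (v t x))\<^sup>2 = clip b (v t x) * \<psi> (v t x) * v t x"
        by (simp add: power2_eq_square \<psi>(1))
      then show ?thesis
        by (simp add: W2_def R_def a_def u_def v_def algebra_simps)
    qed
    moreover have "0 - 2 * b * b < 0"
      using b by simp
    ultimately show "\<exists>a g \<alpha> A \<beta>.
      (AE x in lebesgue_on \<Omega>. W2 t x = d2 * Gam \<Omega> \<gamma>2 (v t) x - a x * v t x + g x) \<and>
      (AE x in lebesgue_on \<Omega>. \<alpha> \<le> a x \<and> a x \<le> A) \<and>
      (AE x in lebesgue_on \<Omega>. \<bar>g x\<bar> \<le> \<beta>) \<and> 0 \<le> \<beta> \<and> \<beta> - \<alpha> * b < 0"
      by (intro exI[of _ a] exI[of _ "\<lambda>x. 0"] exI[of _ "2 * b"] exI[of _ "6 * b"] exI[of _ 0])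
        (auto intro!: AE_I2)
  next
    show "Linf \<Omega> (v 0) \<le> b"
      using Linf_cong_AE[OF init(2)] v0 by (simp add: b_def)
  qed (use par that in auto)
  have R: "AE x in lebesgue_on \<Omega>. R (w t) x = u t x * (v t x)\<^sup>2" if "0 \<le> t" for t
    using AE_abs_le_Linf[OF bmeasfun_Xsp[of "fst (w t)" \<Omega>]] AE_abs_le_Linf[OF bmeasfun_Xsp[of "snd (w t)" \<Omega>]]
  proof eventually_elim
    case (elim x)
    then show ?case
      using u_le[OF that] v_le[OF that] by (simp add: R_def u_def v_def clip_eq)
  qed
  have "C1_X \<Omega> u (\<lambda>t. Fu \<Omega> d1 f \<gamma>1 (u t) (v t))"
  proof (rule C1)
    fix t :: real assume "0 \<le> t"
    show "AE x in lebesgue_on \<Omega>. Fu \<Omega> d1 f \<gamma>1 (u t) (v t) x = W1 t x"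
      using R[OF \<open>0 \<le> t\<close>] by eventually_elim (simp add: Fu_def W1_def)
  qed
  moreover have "C1_X \<Omega> v (\<lambda>t. Fv \<Omega> d2 f \<kappa> \<gamma>2 (u t) (v t))"
  proof (rule C2)
    fix t :: real assume "0 \<le> t"
    show "AE x in lebesgue_on \<Omega>. Fv \<Omega> d2 f \<kappa> \<gamma>2 (u t) (v t) x = W2 t x"
      using R[OF \<open>0 \<le> t\<close>] by eventually_elim (simp add: Fv_def W2_def)
  qed
  ultimately have "is_solution \<Omega> d1 d2 f \<kappa> \<gamma>1 \<gamma>2 u0 v0 u v"
    using init by (simp add: is_solution_def)
  then show ?thesis
    by blast
qed

lemma Linf_le_one_plus:
  assumes "z \<in> Xsp \<Omega>"
  shows "Linf \<Omega> z \<le> 1 + Linf \<Omega> (\<lambda>x. z x - 1)"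
proof -
  have "Linf \<Omega> (\<lambda>x. 1) \<le> 1"
    by (rule Linf_le) auto
  then show ?thesis
    using Linf_triangle[OF Xsp_const Xsp_diff[OF assms Xsp_const], of 1 1] by simp
qed

section \<open>Stability of the semi-trivial state\<close>

theorem theorem1p2:
  fixes \<Omega> :: "(real ^ 'n) set"
    and d1 d2 f \<kappa> \<gamma>inf :: real
    and \<gamma>1 \<gamma>2 :: "real ^ 'n \<Rightarrow> real ^ 'n \<Rightarrow> real"
  assumes dom: "open \<Omega>" "connected \<Omega>" "bounded \<Omega>" "\<Omega> \<noteq> {}"
    and par: "0 < d1" "0 < d2" "0 < f" "0 < \<kappa>"
    and ginf: "1 \<le> \<gamma>inf"
    and g1meas: "(\<lambda>(x, y). \<gamma>1 x y) \<in> borel_measurable (lebesgue_on (\<Omega> \<times> \<Omega>))"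
    and g2meas: "(\<lambda>(x, y). \<gamma>2 x y) \<in> borel_measurable (lebesgue_on (\<Omega> \<times> \<Omega>))"
    and g1nn: "\<And>x y. x \<in> \<Omega> \<Longrightarrow> y \<in> \<Omega> \<Longrightarrow> 0 \<le> \<gamma>1 x y"
    and g2nn: "\<And>x y. x \<in> \<Omega> \<Longrightarrow> y \<in> \<Omega> \<Longrightarrow> 0 \<le> \<gamma>2 x y"
    and g1sym: "\<And>x. x \<in> \<Omega> \<Longrightarrow>
        (\<integral>\<^sup>+ y. ennreal (\<gamma>1 y x) \<partial>lebesgue_on \<Omega>) = (\<integral>\<^sup>+ y. ennreal (\<gamma>1 x y) \<partial>lebesgue_on \<Omega>)"
    and g2sym: "\<And>x. x \<in> \<Omega> \<Longrightarrow>
        (\<integral>\<^sup>+ y. ennreal (\<gamma>2 y x) \<partial>lebesgue_on \<Omega>) = (\<integral>\<^sup>+ y. ennreal (\<gamma>2 x y) \<partial>lebesgue_on \<Omega>)"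
    and g1bd: "\<And>x. x \<in> \<Omega> \<Longrightarrow> (\<integral>\<^sup>+ y. ennreal (\<gamma>1 x y) \<partial>lebesgue_on \<Omega>) \<le> ennreal \<gamma>inf"
    and g2bd: "\<And>x. x \<in> \<Omega> \<Longrightarrow> (\<integral>\<^sup>+ y. ennreal (\<gamma>2 x y) \<partial>lebesgue_on \<Omega>) \<le> ennreal \<gamma>inf"
  shows "loc_asympt_stable_10 \<Omega> d1 d2 f \<kappa> \<gamma>1 \<gamma>2 \<and>
    (\<forall>u0 v0 \<delta> u v.
       u0 \<in> Xplus \<Omega> \<and> v0 \<in> Xplus \<Omega> \<and> 0 \<le> \<delta> \<and>
       Linf \<Omega> u0 \<le> 1 + \<delta> \<and> Linf \<Omega> v0 < (f + \<kappa>) / (1 + \<delta>) \<and>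
       is_solution \<Omega> d1 d2 f \<kappa> \<gamma>1 \<gamma>2 u0 v0 u v \<longrightarrow>
         ((\<lambda>t. Linf \<Omega> (\<lambda>x. u t x - 1) + Linf \<Omega> (v t)) \<longlongrightarrow> 0) at_top \<and>
         (\<forall>t\<ge>0. Linf \<Omega> (u t) \<le> 1 + \<delta> \<and> Linf \<Omega> (v t) \<le> Linf \<Omega> v0))"
proof -
  have leb: "\<Omega> \<in> sets lebesgue"
    using dom(1) by auto
  have C: "0 \<le> \<gamma>inf"
    using ginf by simp
  obtain g1 where g1: "borel_kernel g1 \<gamma>inf" "kernel_version \<Omega> \<gamma>1 g1"
    using borel_kernel_version_exists[OF dom(1) g1meas g1nn g1bd] .
  obtain g2 where g2: "borel_kernel g2 \<gamma>inf" "kernel_version \<Omega> \<gamma>2 g2"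
    using borel_kernel_version_exists[OF dom(1) g2meas g2nn g2bd] .
  note diff = diffusive_kernel_version[OF leb g1 C] diffusive_kernel_version[OF leb g2 C] C
  define c where "c = f + \<kappa>"
  have c: "0 < c"
    using par by (simp add: c_def)
  \<comment> \<open>Stated for a general level \<open>U\<close>: the final claim takes
    \<open>U = 1 + \<delta>\<close>, local attractivity takes \<open>U = 2\<close>.\<close>
  have part2: "((\<lambda>t. Linf \<Omega> (\<lambda>x. u t x - 1) + Linf \<Omega> (v t)) \<longlongrightarrow> 0) at_top"
      "\<And>t. 0 \<le> t \<Longrightarrow> Linf \<Omega> (u t) \<le> U" "\<And>t. 0 \<le> t \<Longrightarrow> Linf \<Omega> (v t) \<le> Linf \<Omega> v0"
    if sol: "is_solution \<Omega> d1 d2 f \<kappa> \<gamma>1 \<gamma>2 u0 v0 u v"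
      and U: "1 \<le> U" "Linf \<Omega> u0 \<le> U" and v0: "Linf \<Omega> v0 < (f + \<kappa>) / U"
    for u0 v0 u v U
  proof -
    obtain V where V: "Linf \<Omega> v0 < V" "V < (f + \<kappa>) / U"
      using dense[OF v0] by blast
    then have UV: "U * V < f + \<kappa>"
      using U by (simp add: field_simps)
    show "((\<lambda>t. Linf \<Omega> (\<lambda>x. u t x - 1) + Linf \<Omega> (v t)) \<longlongrightarrow> 0) at_top"
      using solution_tendsto[OF diff par(1-3) sol U V(1) UV refl] .
    show "Linf \<Omega> (u t) \<le> U" if "0 \<le> t" for t
      using solution_u_le[OF diff par(1-3) sol U that] .
    show "Linf \<Omega> (v t) \<le> Linf \<Omega> v0" if "0 \<le> t" for t
      using solution_v_le_initial[OF diff par(1-3) sol U v0 that] .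
  qed
  have near: "Linf \<Omega> u0 \<le> 2 \<and> Linf \<Omega> v0 < \<eta> \<and> Linf \<Omega> (\<lambda>x. u0 x - 1) < \<eta>"
    if X: "u0 \<in> Xsp \<Omega>" "v0 \<in> Xsp \<Omega>" and \<eta>: "Linf \<Omega> (\<lambda>x. u0 x - 1) + Linf \<Omega> v0 < \<eta>" "\<eta> \<le> 1"
    for u0 v0 \<eta>
    using Linf_le_one_plus[OF X(1)] Linf_nonneg[OF X(2)] Linf_nonneg[OF Xsp_diff[OF X(1) Xsp_const, of 1]] \<eta>
    by linarith
  have "loc_asympt_stable_10 \<Omega> d1 d2 f \<kappa> \<gamma>1 \<gamma>2"
    unfolding loc_asympt_stable_10_def
  proof (intro conjI allI impI)
    fix \<epsilon> :: real assume \<epsilon>: "0 < \<epsilon>"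
    \<comment> \<open>The bound 1 gives \<open>Linf \<Omega> u0 \<le> 2\<close>;
      \<open>c / 4\<close> gives existence and \<open>2 * \<eta> < f + \<kappa>\<close>;
      \<open>\<epsilon> / 4\<close> controls \<open>v\<close>; and
      \<open>f * \<epsilon> / 8\<close>, together with \<eta> at most 1, keeps the forcing term
      \<open>2 * \<eta>\<^sup>2 / f\<close> below \<open>\<epsilon> / 4\<close>.\<close>
    define \<eta> where "\<eta> = Min {1, c / 4, \<epsilon> / 4, f * \<epsilon> / 8}"
    have \<eta>: "0 < \<eta>" "\<eta> \<le> 1" "\<eta> \<le> c / 4" "\<eta> \<le> \<epsilon> / 4" "\<eta> \<le> f * \<epsilon> / 8"
      using c \<epsilon> par by (auto simp: \<eta>_def)
    have "\<eta>\<^sup>2 \<le> f * \<epsilon> / 8"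
      unfolding power2_eq_square using mult_left_mono[OF \<eta>(2) less_imp_le[OF \<eta>(1)]] \<eta>(5) by linarith
    then have \<eta>2: "2 * \<eta>\<^sup>2 / f \<le> \<epsilon> / 4"
      using par by (simp add: field_simps)
    \<comment> \<open>Strictly above \<open>\<epsilon> / 4\<close>, which bounds both the initial
      deviation and the forcing term, yet \<open>B + \<epsilon> / 4\<close> stays below
      \<epsilon>.\<close>
    define B where "B = 3 * \<epsilon> / 8"
    show "\<exists>\<eta>>0. \<forall>u0\<in>Xsp \<Omega>. \<forall>v0\<in>Xsp \<Omega>. Linf \<Omega> (\<lambda>x. u0 x - 1) + Linf \<Omega> v0 < \<eta> \<longrightarrow>
          (\<exists>u v. is_solution \<Omega> d1 d2 f \<kappa> \<gamma>1 \<gamma>2 u0 v0 u v) \<and>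
          (\<forall>u v. is_solution \<Omega> d1 d2 f \<kappa> \<gamma>1 \<gamma>2 u0 v0 u v \<longrightarrow>
             (\<forall>t\<ge>0. Linf \<Omega> (\<lambda>x. u t x - 1) + Linf \<Omega> (v t) < \<epsilon>))"
    proof (intro exI[of _ \<eta>] conjI ballI impI allI)
      fix u0 v0 assume X: "u0 \<in> Xsp \<Omega>" "v0 \<in> Xsp \<Omega>" and "Linf \<Omega> (\<lambda>x. u0 x - 1) + Linf \<Omega> v0 < \<eta>"
      then have small: "Linf \<Omega> u0 \<le> 2" "Linf \<Omega> v0 < \<eta>" "Linf \<Omega> (\<lambda>x. u0 x - 1) < \<eta>"
        using near[OF X _ \<eta>(2)] by auto
      have "Linf \<Omega> v0 \<le> (f + \<kappa>) / 4"
        using small \<eta>(3) by (simp add: c_def)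
      then show "\<exists>u v. is_solution \<Omega> d1 d2 f \<kappa> \<gamma>1 \<gamma>2 u0 v0 u v"
        using small_data_solution_exists[OF dom(1) g1 g2 C par X(1) small(1) X(2)] by blast
      fix u v t assume sol: "is_solution \<Omega> d1 d2 f \<kappa> \<gamma>1 \<gamma>2 u0 v0 u v" and t: "0 \<le> (t::real)"
      have UV: "2 * \<eta> < f + \<kappa>"
        using \<eta>(3) c by (simp add: c_def)
      define r where "r = (f + \<kappa> - 2 * \<eta>) / 2"
      define s where "s = min (f / 2) r"
      have rs: "0 \<le> r * t" "0 \<le> s * t"
        using UV t par by (auto simp: r_def s_def)
      have "Linf \<Omega> (v t) \<le> \<eta> * exp (- r * t)"
        using solution_v_le[OF diff par(1-3) sol _ small(1,2) UV r_def t] by simp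
      also have "\<dots> \<le> \<eta>"
        using rs \<eta> by (simp add: mult_le_cancel_left1)
      finally have "Linf \<Omega> (v t) \<le> \<epsilon> / 4"
        using \<eta> by simp
      moreover have "Linf \<Omega> (\<lambda>x. u t x - 1) \<le> B * exp (- s * t)"
        using solution_u_minus_one_le[OF diff par(1-3) sol _ small(1,2) UV r_def _ _ s_def t, of B]
          small(3) \<eta> \<eta>2 \<epsilon> by (simp add: B_def)
      moreover have "B * exp (- s * t) \<le> B"
        using rs \<epsilon> by (simp add: B_def mult_le_cancel_left1)
      ultimately show "Linf \<Omega> (\<lambda>x. u t x - 1) + Linf \<Omega> (v t) < \<epsilon>"
        using \<epsilon> unfolding B_def by linarith
    qed (rule \<eta>)
  next
    \<comment> \<open>\<open>c / 2\<close> is the threshold for \<open>v0\<close> at the level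
      \<open>U = 2\<close>.\<close>
    define \<eta> where "\<eta> = min 1 (c / 2)"
    have \<eta>: "0 < \<eta>" "\<eta> \<le> 1" "\<eta> \<le> c / 2"
      using c by (simp_all add: \<eta>_def)
    show "\<exists>\<eta>>0. \<forall>u0\<in>Xsp \<Omega>. \<forall>v0\<in>Xsp \<Omega>. Linf \<Omega> (\<lambda>x. u0 x - 1) + Linf \<Omega> v0 < \<eta> \<longrightarrow>
          (\<forall>u v. is_solution \<Omega> d1 d2 f \<kappa> \<gamma>1 \<gamma>2 u0 v0 u v \<longrightarrow>
             ((\<lambda>t. Linf \<Omega> (\<lambda>x. u t x - 1) + Linf \<Omega> (v t)) \<longlongrightarrow> 0) at_top)"
    proof (intro exI[of _ \<eta>] conjI ballI impI allI)
      fix u0 v0 u v assume X: "u0 \<in> Xsp \<Omega>" "v0 \<in> Xsp \<Omega>"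
        and lt: "Linf \<Omega> (\<lambda>x. u0 x - 1) + Linf \<Omega> v0 < \<eta>"
        and sol: "is_solution \<Omega> d1 d2 f \<kappa> \<gamma>1 \<gamma>2 u0 v0 u v"
      have "Linf \<Omega> u0 \<le> 2" "Linf \<Omega> v0 < (f + \<kappa>) / 2"
        using near[OF X lt \<eta>(2)] \<eta>(3) by (simp_all add: c_def)
      then show "((\<lambda>t. Linf \<Omega> (\<lambda>x. u t x - 1) + Linf \<Omega> (v t)) \<longlongrightarrow> 0) at_top"
        using part2(1)[OF sol, of 2] by simp
    qed (rule \<eta>)
  qed
  moreover have "((\<lambda>t. Linf \<Omega> (\<lambda>x. u t x - 1) + Linf \<Omega> (v t)) \<longlongrightarrow> 0) at_top \<and>
      (\<forall>t\<ge>0. Linf \<Omega> (u t) \<le> 1 + \<delta> \<and> Linf \<Omega> (v t) \<le> Linf \<Omega> v0)"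
    if "0 \<le> \<delta>" "Linf \<Omega> u0 \<le> 1 + \<delta>" "Linf \<Omega> v0 < (f + \<kappa>) / (1 + \<delta>)"
      "is_solution \<Omega> d1 d2 f \<kappa> \<gamma>1 \<gamma>2 u0 v0 u v" for u0 v0 \<delta> u v
    using part2[OF that(4) _ that(2,3)] that(1) by simp
  ultimately show ?thesis
    by blast
qed

end
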